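(* Let $D\geq 1$ be an integer. Every $(D,\mathrm{F})$-critical multigraph $G$ with $|V(G)|\geq 3$ satisfies $|E(G)|\geq \frac{(4D+3)|V(G)|+2}{2(D+1)}$.
   Context: All multigraphs are loopless; edges are counted with multiplicity. A forest is an acyclic multigraph, where a pair of parallel edges counts as a cycle. A $(D,\mathrm{F})$-coloring of a multigraph $G$ is a partition $(M,F)$ of $V(G)$ such that $G[M]$ is a forest with maximum degree at most $D$ and $G[F]$ is a forest. A multigraph is $(D,\mathrm{F})$-critical if it has no $(D,\mathrm{F})$-coloring but every proper subgraph of it has one. *)

theory Defs
  imports Complex_Main "HOL-Library.Multiset"
begin

text \<open>
  An edge is the two-element set of its ends, and the edges form a multiset, so that
  the multiplicity of a pair of vertices is the number of parallel edges joining it.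
\<close>

record 'v mgraph =
  mverts :: "'v set"
  medges :: "'v set multiset"

definition multigraph :: "'v mgraph \<Rightarrow> bool" where
  "multigraph G \<longleftrightarrow>
     finite (mverts G) \<and> (\<forall>e \<in># medges G. e \<subseteq> mverts G \<and> card e = 2)"

definition subgraph :: "'v mgraph \<Rightarrow> 'v mgraph \<Rightarrow> bool" where
  "subgraph H G \<longleftrightarrow>
     multigraph H \<and> mverts H \<subseteq> mverts G \<and> medges H \<subseteq># medges G"

definition proper_subgraph :: "'v mgraph \<Rightarrow> 'v mgraph \<Rightarrow> bool" where
  "proper_subgraph H G \<longleftrightarrow> subgraph H G \<and> H \<noteq> G"

definition induced :: "'v mgraph \<Rightarrow> 'v set \<Rightarrow> 'v mgraph" where
  "induced G S =
     \<lparr>mverts = mverts G \<inter> S, medges = filter_mset (\<lambda>e. e \<subseteq> S) (medges G)\<rparr>"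

definition degree :: "'v mgraph \<Rightarrow> 'v \<Rightarrow> nat" where
  "degree G v = size (filter_mset (\<lambda>e. v \<in> e) (medges G))"

text \<open>
  The edges of the closed vertex sequence \<open>vs\<close>. For \<open>vs = [a, b]\<close> the pair \<open>{a, b}\<close>
  occurs twice, so \<open>[a, b]\<close> is a cycle exactly if \<open>a\<close> and \<open>b\<close> are joined by at least
  two parallel edges.
\<close>

definition cycle_edges :: "'v list \<Rightarrow> 'v set multiset" where
  "cycle_edges vs =
     mset (map (\<lambda>i. {vs ! i, vs ! (Suc i mod length vs)}) [0..<length vs])"

definition cycle :: "'v mgraph \<Rightarrow> 'v list \<Rightarrow> bool" where
  "cycle G vs \<longleftrightarrow>
     2 \<le> length vs \<and> distinct vs \<and> set vs \<subseteq> mverts G \<and> cycle_edges vs \<subseteq># medges G"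

definition forest :: "'v mgraph \<Rightarrow> bool" where
  "forest G \<longleftrightarrow> multigraph G \<and> (\<nexists>vs. cycle G vs)"

text \<open>Either part of the partition may be empty.\<close>

definition DF_coloring :: "nat \<Rightarrow> 'v mgraph \<Rightarrow> 'v set \<Rightarrow> 'v set \<Rightarrow> bool" where
  "DF_coloring D G M F \<longleftrightarrow>
     M \<union> F = mverts G \<and> M \<inter> F = {} \<and>
     forest (induced G M) \<and> (\<forall>v \<in> M. degree (induced G M) v \<le> D) \<and>
     forest (induced G F)"

definition DF_colorable :: "nat \<Rightarrow> 'v mgraph \<Rightarrow> bool" where
  "DF_colorable D G \<longleftrightarrow> (\<exists>M F. DF_coloring D G M F)"

definition DF_critical :: "nat \<Rightarrow> 'v mgraph \<Rightarrow> bool" where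
  "DF_critical D G \<longleftrightarrow>
     multigraph G \<and> \<not> DF_colorable D G \<and>
     (\<forall>H. proper_subgraph H G \<longrightarrow> DF_colorable D H)"

end

theory Submission
  imports Defs
begin

text \<open>
  Put \<open>N = D + 1\<close>, let every vertex \<open>v\<close> carry a capacity \<open>k v \<le> N\<close> (it may join \<open>M\<close> only with
  fewer than \<open>k v\<close> neighbours there), and give a vertex set \<open>S\<close> the potential
  \<open>\<rho> S = (\<Sum>v\<in>S. 2 N - 1 + 2 k v) - 2 N e(S)\<close>. If \<open>\<rho> \<ge> -1\<close> on all nonempty sets, then a colouring exists.
  In a vertex-minimal counterexample a colouring of a set \<open>S\<close> extends, after the \<open>F\<close>-part of \<open>S\<close> has
  been contracted to one vertex of capacity 0 and the neighbours of its \<open>M\<close>-part have been forced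
  into \<open>F\<close>, unless some larger set has potential at most \<open>\<rho> S - 2\<close>; hence proper sets with at
  least two vertices have potential at least \<open>2 N\<close>. This leaves room to lower capacities
  near a vertex before colouring the rest. For \<open>N \<ge> 3\<close> it excludes vertices of degree 3 and
  capacity at least 2, and then all summands of
  \<open>\<rho> V = (\<Sum>v\<in>V. 2 N - 1 + 2 k v - N deg v)\<close> are negative. For \<open>N = 2\<close> such vertices may
  exist, but they are independent and their neighbours see few of them; discharging leaves only
  \<open>K\<^sub>5\<close> minus an edge, which is colourable.
\<close>

section \<open>Edge counts and acyclicity\<close>

text \<open>Capacities enter because the induction creates them: a contracted \<open>F\<close>-part
  needs a vertex barred from \<open>M\<close>, and the neighbours of a fixed \<open>M\<close>-part
  have to be barred as well. If every capacity is \<open>N\<close>, a vertex weighs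
  \<open>4 N - 1 = 4 D + 3\<close> and an edge \<open>2 N = 2 (D + 1)\<close>, so the claim says
  that a critical multigraph has potential at most -2. The shape of the proof comes from a count of
  slack. A set of potential \<open>2 N\<close> can lose \<open>2 N + 1\<close> and still be at -1,
  while a unit of capacity costs 2. Lowering all three neighbours of a vertex of degree 3 costs 6,
  which fits for \<open>N \<ge> 3\<close> and misses by one for \<open>N = 2\<close>. In that case
  some capacity must be spared, and one has to know exactly which sets would fall below -1.
  Discharging dictates what is needed: a vertex of degree 3 has surplus 1 to share among three
  neighbours, so a vertex of capacity 2 and degree 4, whose charge is -1, may have only two such
  neighbours.\<close>

text \<open>
  A multigraph is given by its multiplicities \<open>m u v\<close>. As \<open>links\<close> counts ordered pairs,
  \<open>links m S S\<close> is twice the number of edges inside \<open>S\<close>, and \<open>links m {v} S\<close> is the number of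
  edges from \<open>v\<close> to \<open>S\<close>. Acyclicity is expressed by edge counts so that it combines with
  unions and contractions.
\<close>

definition links :: "('v \<Rightarrow> 'v \<Rightarrow> nat) \<Rightarrow> 'v set \<Rightarrow> 'v set \<Rightarrow> int" where
  "links m X Y = (\<Sum>x\<in>X. \<Sum>y\<in>Y. int (m x y))"

definition multiplicity_fun :: "('v \<Rightarrow> 'v \<Rightarrow> nat) \<Rightarrow> bool" where
  "multiplicity_fun m \<longleftrightarrow> (\<forall>u v. m u v = m v u) \<and> (\<forall>v. m v v = 0)"

text \<open>The doubled form of e(Y) \<le> |Y| - 1; a pair of parallel edges already violates it on
  its two ends.\<close>

definition acyc :: "('v \<Rightarrow> 'v \<Rightarrow> nat) \<Rightarrow> 'v set \<Rightarrow> bool" where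
  "acyc m F \<longleftrightarrow> (\<forall>Y. Y \<subseteq> F \<longrightarrow> Y \<noteq> {} \<longrightarrow> links m Y Y + 2 \<le> 2 * int (card Y))"

text \<open>The strict inequality lets capacity 0 bar a vertex from \<open>M\<close>, while capacity
  \<open>D + 1\<close> means degree at most \<open>D\<close>.\<close>

definition col :: "('v \<Rightarrow> 'v \<Rightarrow> nat) \<Rightarrow> ('v \<Rightarrow> nat) \<Rightarrow> 'v set \<Rightarrow> 'v set \<Rightarrow> bool" where
  "col m k V M \<longleftrightarrow> M \<subseteq> V \<and> acyc m M \<and> acyc m (V - M) \<and> (\<forall>v\<in>M. links m {v} M < int (k v))"

text \<open>
  A vertex of capacity \<open>N - j\<close> behaves like a vertex of capacity \<open>N\<close> with \<open>j\<close> pendant digons, each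
  of which costs \<open>2 (4 N - 1) - 4 * 2 N = -2\<close>: this is where the weight 2 per unit of capacity comes
  from.
\<close>

definition pot :: "int \<Rightarrow> ('v \<Rightarrow> 'v \<Rightarrow> nat) \<Rightarrow> ('v \<Rightarrow> nat) \<Rightarrow> 'v set \<Rightarrow> int" where
  "pot N m k S = (\<Sum>v\<in>S. 2 * N - 1 + 2 * int (k v)) - N * links m S S"

lemma links_nonneg [simp]: "0 \<le> links m X Y"
  unfolding links_def by (simp add: sum_nonneg)

lemma links_not_neg [simp]: "\<not> links m X Y < 0"
  by (simp add: not_less)

lemma links_not_pos: "\<not> 0 < links m X Y \<longleftrightarrow> links m X Y = 0"
  using links_nonneg[of m X Y] by linarith

lemma links_empty [simp]: "links m {} Y = 0" "links m X {} = 0"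
  unfolding links_def by auto

lemma multiplicity_sym: "multiplicity_fun m \<Longrightarrow> m u v = m v u"
  unfolding multiplicity_fun_def by blast

lemma links_sym: "multiplicity_fun m \<Longrightarrow> links m X Y = links m Y X"
  unfolding links_def by (subst sum.swap) (intro sum.cong refl, simp add: multiplicity_sym[of m])

lemma links_Un_left:
  "finite X \<Longrightarrow> finite X' \<Longrightarrow> X \<inter> X' = {} \<Longrightarrow> links m (X \<union> X') Y = links m X Y + links m X' Y"
  unfolding links_def by (simp add: sum.union_disjoint)

lemma links_Un_right:
  "finite Y \<Longrightarrow> finite Y' \<Longrightarrow> Y \<inter> Y' = {} \<Longrightarrow> links m X (Y \<union> Y') = links m X Y + links m X Y'"
  unfolding links_def by (simp add: sum.union_disjoint sum.distrib)

lemma links_insert_left: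
  "finite X \<Longrightarrow> x \<notin> X \<Longrightarrow> links m (insert x X) Y = links m {x} Y + links m X Y"
  unfolding links_def by simp

lemma links_insert_right:
  "finite Y \<Longrightarrow> y \<notin> Y \<Longrightarrow> links m X (insert y Y) = links m X {y} + links m X Y"
  unfolding links_def by (simp add: sum.distrib)

lemma links_singleton: "links m {x} {y} = int (m x y)"
  unfolding links_def by simp

lemma links_singleton_left: "links m {x} Y = (\<Sum>y\<in>Y. int (m x y))"
  unfolding links_def by simp

lemma links_sum_left: "links m X Y = (\<Sum>x\<in>X. links m {x} Y)"
  unfolding links_def by simp

lemma links_mono:
  assumes "finite X'" "finite Y'" "X \<subseteq> X'" "Y \<subseteq> Y'"
  shows "links m X Y \<le> links m X' Y'"
proof -
  have "links m X Y \<le> links m X Y'"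
    unfolding links_def using assms by (intro sum_mono sum_mono2) auto
  also have "\<dots> \<le> links m X' Y'"
    unfolding links_def using assms by (intro sum_mono2 sum_nonneg) auto
  finally show ?thesis .
qed

lemma links_cong:
  "(\<And>x y. x \<in> X \<Longrightarrow> y \<in> Y \<Longrightarrow> m x y = m' x y) \<Longrightarrow> links m X Y = links m' X Y"
  unfolding links_def by (intro sum.cong refl) auto

lemma links_Un_self:
  assumes "multiplicity_fun m" "finite X" "finite Y" "X \<inter> Y = {}"
  shows "links m (X \<union> Y) (X \<union> Y) = links m X X + links m Y Y + 2 * links m X Y"
  using assms links_sym[of m Y X] by (simp add: links_Un_left links_Un_right)

lemma links_insert_self:
  assumes "multiplicity_fun m" "finite X" "v \<notin> X"
  shows "links m (insert v X) (insert v X) = links m X X + 2 * links m {v} X"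
  using links_Un_self[of m "{v}" X] assms by (simp add: links_singleton multiplicity_fun_def)

lemma links_eq_0D:
  assumes "links m X Y = 0" "finite X" "finite Y" "x \<in> X" "y \<in> Y"
  shows "m x y = 0"
proof -
  have "links m {x} {y} \<le> links m X Y" using assms by (intro links_mono) auto
  then show ?thesis using assms by (simp add: links_singleton)
qed

lemma links_pos_iff:
  assumes "finite X" "finite Y"
  shows "0 < links m X Y \<longleftrightarrow> (\<exists>x\<in>X. \<exists>y\<in>Y. 0 < m x y)"
proof
  assume "0 < links m X Y"
  show "\<exists>x\<in>X. \<exists>y\<in>Y. 0 < m x y"
  proof (rule ccontr)
    assume "\<not> ?thesis"
    then have "links m X Y = 0" unfolding links_def by (intro sum.neutral ballI) auto
    then show False using \<open>0 < links m X Y\<close> by simp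
  qed
next
  assume "\<exists>x\<in>X. \<exists>y\<in>Y. 0 < m x y"
  then show "0 < links m X Y"
    using links_eq_0D[OF _ assms, of m] links_nonneg[of m X Y] by (metis less_le neq0_conv)
qed

lemma links_one_unique:
  assumes "links m {v} X = 1" "finite X"
  obtains x where "x \<in> X" "m v x = 1" "\<And>u. u \<in> X \<Longrightarrow> u \<noteq> x \<Longrightarrow> m v u = 0"
proof -
  obtain x where x: "x \<in> X" "0 < m v x"
    using links_pos_iff[of "{v}" X m] assms by auto
  have "links m {v} (insert x (X - {x})) = int (m v x) + links m {v} (X - {x})"
    using assms by (subst links_insert_right) (auto simp: links_singleton)
  moreover have "insert x (X - {x}) = X" using x by auto
  ultimately have "int (m v x) + links m {v} (X - {x}) = 1" using assms by simp
  moreover have "0 \<le> links m {v} (X - {x})" by simp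
  ultimately have "m v x = 1" "links m {v} (X - {x}) = 0" using x by linarith+
  then show ?thesis using that[of x] x links_eq_0D[of m "{v}" "X - {x}" v] assms(2) by auto
qed

lemma acyc_subset: "acyc m F \<Longrightarrow> F' \<subseteq> F \<Longrightarrow> acyc m F'"
  unfolding acyc_def by blast

lemma acyc_empty [simp]: "acyc m {}"
  unfolding acyc_def by auto

lemma acyc_cong:
  assumes "\<And>x y. x \<in> F \<Longrightarrow> y \<in> F \<Longrightarrow> m x y = m' x y"
  shows "acyc m F \<longleftrightarrow> acyc m' F"
proof -
  have "links m Y Y = links m' Y Y" if "Y \<subseteq> F" for Y
    using assms that by (intro links_cong) auto
  then show ?thesis unfolding acyc_def by simp
qed

lemma acyc_links_le:
  assumes "acyc m F" "\<And>Y. Y \<subseteq> F \<Longrightarrow> links m' Y Y \<le> links m Y Y"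
  shows "acyc m' F"
  using assms unfolding acyc_def by (meson add_right_mono order_trans)

lemma acyc_Un:
  assumes "multiplicity_fun m" "finite A" "finite B" "A \<inter> B = {}"
    and "acyc m A" "acyc m B" "links m A B \<le> 1"
  shows "acyc m (A \<union> B)"
  unfolding acyc_def
proof (intro allI impI)
  fix Y assume Y: "Y \<subseteq> A \<union> B" "Y \<noteq> {}"
  define P where "P = Y \<inter> A"
  define Q where "Q = Y \<inter> B"
  have Yeq: "Y = P \<union> Q" and sub: "P \<subseteq> A" "Q \<subseteq> B" and dis: "P \<inter> Q = {}"
    using Y assms(4) unfolding P_def Q_def by auto
  have fin: "finite P" "finite Q" using assms sub finite_subset by blast+
  have l: "links m Y Y = links m P P + links m Q Q + 2 * links m P Q"
    using links_Un_self[OF assms(1) fin dis] Yeq by simp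
  have c: "card Y = card P + card Q" using Yeq card_Un_disjoint[OF fin dis] by simp
  have PQ: "links m P Q \<le> 1"
    using links_mono[OF assms(2,3) sub, of m] assms(7) by linarith
  have p: "P \<noteq> {} \<Longrightarrow> links m P P + 2 \<le> 2 * int (card P)" and q: "Q \<noteq> {} \<Longrightarrow> links m Q Q + 2 \<le> 2 * int (card Q)"
    using assms(5,6) sub unfolding acyc_def by auto
  consider "P = {}" "Q \<noteq> {}" | "Q = {}" "P \<noteq> {}" | "P \<noteq> {}" "Q \<noteq> {}"
    using Y Yeq by auto
  then show "links m Y Y + 2 \<le> 2 * int (card Y)"
  proof cases
    case 1 then show ?thesis using l c q by simp
  next
    case 2 then show ?thesis using l c p by simp
  next
    case 3 then show ?thesis using l c p q PQ by simp
  qed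
qed

section \<open>Potentials and extension of colourings\<close>

definition sparse :: "int \<Rightarrow> ('v \<Rightarrow> 'v \<Rightarrow> nat) \<Rightarrow> ('v \<Rightarrow> nat) \<Rightarrow> 'v set \<Rightarrow> bool" where
  "sparse N m k V \<longleftrightarrow>
     finite V \<and> (\<forall>v\<in>V. int (k v) \<le> N) \<and> (\<forall>S. S \<subseteq> V \<longrightarrow> S \<noteq> {} \<longrightarrow> -1 \<le> pot N m k S)"

lemma pot_empty [simp]: "pot N m k {} = 0"
  unfolding pot_def by simp

lemma pot_Un:
  assumes "multiplicity_fun m" "finite S" "finite W" "S \<inter> W = {}"
  shows "pot N m k (S \<union> W) = pot N m k S + pot N m k W - 2 * N * links m S W"
  unfolding pot_def links_Un_self[OF assms] using assms
  by (simp add: sum.union_disjoint algebra_simps)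

lemma pot_singleton:
  "multiplicity_fun m \<Longrightarrow> pot N m k {v} = 2 * N - 1 + 2 * int (k v)"
  unfolding pot_def by (simp add: links_singleton multiplicity_fun_def)

lemma pot_insert:
  assumes "multiplicity_fun m" "finite S" "v \<notin> S"
  shows "pot N m k (insert v S) = pot N m k S + (2 * N - 1 + 2 * int (k v)) - 2 * N * links m {v} S"
  using pot_Un[of m "{v}" S N k] assms pot_singleton[of m N k v] by simp

lemma pot_caps_diff:
  "pot N m k' S = pot N m k S - 2 * (\<Sum>v\<in>S. int (k v) - int (k' v))"
  unfolding pot_def by (simp add: sum.distrib sum_subtractf sum_distrib_left algebra_simps)

lemma sparse_subset: "sparse N m k V \<Longrightarrow> V' \<subseteq> V \<Longrightarrow> sparse N m k V'"
  unfolding sparse_def by (auto intro: finite_subset)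

text \<open>If \<open>Y\<close> meets both sides, in \<open>P\<close> and \<open>Q\<close>, add the
  bound for \<open>P\<close> to the bound for \<open>insert r Q\<close>: the contracted vertex sees
  at least the edges between \<open>P\<close> and \<open>Q\<close>, and its share in the cardinality
  cancels the surplus \<open>+ 2\<close>.\<close>

lemma acyc_uncontract:
  assumes m: "multiplicity_fun m" and fin: "finite A" "finite B" and dis: "A \<inter> B = {}" and r: "r \<notin> B"
    and A: "acyc m A" and B: "acyc m' (insert r B)" and m': "multiplicity_fun m'"
    and eqB: "\<And>u v. u \<in> B \<Longrightarrow> v \<in> B \<Longrightarrow> m' u v = m u v"
    and eqr: "\<And>v. v \<in> B \<Longrightarrow> int (m' r v) = links m {v} A"
  shows "acyc m (A \<union> B)"
  unfolding acyc_def
proof (intro allI impI)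
  fix Y assume Y: "Y \<subseteq> A \<union> B" "Y \<noteq> {}"
  define P where "P = Y \<inter> A"
  define Q where "Q = Y \<inter> B"
  have Yeq: "Y = P \<union> Q" and sub: "P \<subseteq> A" "Q \<subseteq> B" and disj: "P \<inter> Q = {}"
    using Y dis unfolding P_def Q_def by auto
  have finPQ: "finite P" "finite Q" using fin sub finite_subset by blast+
  have l: "links m Y Y = links m P P + links m Q Q + 2 * links m P Q"
    using links_Un_self[OF m finPQ disj] Yeq by simp
  have c: "card Y = card P + card Q" using Yeq card_Un_disjoint[OF finPQ disj] by simp
  have lQ: "links m' Q Q = links m Q Q" using eqB sub by (intro links_cong) auto
  have p: "links m P P + 2 \<le> 2 * int (card P)" if "P \<noteq> {}"
    using A sub that unfolding acyc_def by auto
  have q: "links m Q Q + 2 \<le> 2 * int (card Q)" if "Q \<noteq> {}"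
    using B sub that lQ unfolding acyc_def by (metis subset_insertI2)
  have "links m P Q \<le> links m A Q"
    using fin finPQ sub by (intro links_mono) auto
  also have "\<dots> = links m' {r} Q"
    unfolding links_sym[OF m, of A Q] links_sum_left[of m Q A] links_singleton_left[of m' r Q]
    using eqr sub by (intro sum.cong) auto
  finally have PQ: "links m P Q \<le> links m' {r} Q" .
  have "r \<notin> Q" using r sub by auto
  then have rQ: "links m' (insert r Q) (insert r Q) = links m Q Q + 2 * links m' {r} Q"
    "card (insert r Q) = card Q + 1"
    using links_insert_self[OF m' finPQ(2)] lQ finPQ by auto
  have "insert r Q \<subseteq> insert r B" using sub by auto
  then have "links m' (insert r Q) (insert r Q) + 2 \<le> 2 * int (card (insert r Q))"
    using B unfolding acyc_def by blast
  then have rq: "links m Q Q + 2 * links m' {r} Q \<le> 2 * int (card Q)" using rQ by simp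
  consider "P = {}" "Q \<noteq> {}" | "Q = {}" "P \<noteq> {}" | "P \<noteq> {}" "Q \<noteq> {}"
    using Y Yeq by auto
  then show "links m Y Y + 2 \<le> 2 * int (card Y)"
  proof cases
    case 1 then show ?thesis using l c q by simp
  next
    case 2 then show ?thesis using l c p by simp
  next
    case 3 then show ?thesis using l c p rq PQ by simp
  qed
qed

text \<open>
  The set \<open>S\<close> is replaced by one of its own vertices \<open>r\<close>, with capacity 0, standing for the
  contracted set \<open>S - MS\<close>; a vertex outside \<open>S\<close> that sees \<open>MS\<close> gets capacity 0, which costs at
  most the \<open>2 N\<close> that the lost edge was worth.
\<close>

lemma extend_coloring:
  fixes m :: "'v \<Rightarrow> 'v \<Rightarrow> nat"
  assumes m: "multiplicity_fun m" and N: "1 \<le> N" and fin: "finite V"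
    and kN: "\<And>v. v \<in> V \<Longrightarrow> int (k v) \<le> N" and S: "S \<subseteq> V" "S \<noteq> {}" and MS: "col m k S MS"
    and IH: "\<And>(m' :: 'v \<Rightarrow> 'v \<Rightarrow> nat) k' V'. multiplicity_fun m' \<Longrightarrow> sparse N m' k' V' \<Longrightarrow>
      card V' \<le> card (V - S) + 1 \<Longrightarrow> \<exists>M. col m' k' V' M"
    and W: "\<And>W. W \<subseteq> V - S \<Longrightarrow> W \<noteq> {} \<Longrightarrow>
      pot N m k S - (if 0 < links m W (S - MS) then 2 * N else 1) \<le> pot N m k (S \<union> W)"
  obtains M where "col m k V M" "M \<inter> S = MS" "links m MS (M - S) = 0"
proof -
  obtain r where r: "r \<in> S" using S by auto
  define Q where "Q = V - S"
  define FS where "FS = S - MS"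
  define k' where "k' = (\<lambda>v. if v = r \<or> 0 < links m {v} MS then 0 else k v)"
  define m' where "m' = (\<lambda>u v. if u = r \<and> v = r then 0 else if u = r then nat (links m {v} FS)
    else if v = r then nat (links m {u} FS) else m u v)"
  have MSS: "MS \<subseteq> S" using MS unfolding col_def by simp
  then have finS: "finite S" "finite Q" "finite MS" "finite FS"
    using fin S finite_subset[of S V] finite_subset[of MS S] unfolding Q_def FS_def by auto
  have rQ: "r \<notin> Q" using r unfolding Q_def by auto
  have SQ: "S \<inter> Q = {}" unfolding Q_def by auto
  have SE: "S = MS \<union> FS" "MS \<inter> FS = {}" using MSS unfolding FS_def by auto
  have m': "multiplicity_fun m'"
    using m unfolding multiplicity_fun_def m'_def by auto
  have eqB: "m' u v = m u v" if "u \<in> Q" "v \<in> Q" for u v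
    using that rQ unfolding m'_def by auto
  have eqr: "int (m' r v) = links m {v} FS" if "v \<in> Q" for v
    using that rQ unfolding m'_def by auto
  \<comment> \<open>The edges to \<open>FS\<close> are added back on the left because they are
    absent inside \<open>U\<close> alone; they return only as edges at \<open>r\<close>.\<close>
  have potW: "pot N m k (S \<union> U) - pot N m k S + 2 * N * links m U FS \<le> pot N m' k' U" if U: "U \<subseteq> Q" for U
  proof -
    have finU: "finite U" "S \<inter> U = {}" using U finS SQ finite_subset[of U Q] by auto
    have "int (k v) - N * links m {v} MS \<le> int (k' v)" if "v \<in> U" for v
    proof (cases "0 < links m {v} MS")
      case True
      then have "N * 1 \<le> N * links m {v} MS" using N by (intro mult_left_mono) auto
      moreover have "int (k v) \<le> N" using kN that U unfolding Q_def by auto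
      ultimately show ?thesis by simp
    next
      case False
      then have "links m {v} MS = 0" using links_nonneg[of m "{v}" MS] by linarith
      moreover have "v \<noteq> r" using that U rQ by auto
      ultimately show ?thesis unfolding k'_def by simp
    qed
    then have "(\<Sum>v\<in>U. int (k v) - N * links m {v} MS) \<le> (\<Sum>v\<in>U. int (k' v))" by (rule sum_mono)
    then have le: "(\<Sum>v\<in>U. int (k v)) - N * links m U MS \<le> (\<Sum>v\<in>U. int (k' v))"
      by (simp add: sum_subtractf sum_distrib_left links_sum_left[of m U MS])
    have "links m' U U = links m U U" using U eqB by (intro links_cong) auto
    then have "pot N m' k' U = (\<Sum>v\<in>U. 2 * N - 1) + 2 * (\<Sum>v\<in>U. int (k' v)) - N * links m U U"
      unfolding pot_def by (simp add: sum.distrib sum_distrib_left)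
    moreover have "pot N m k U = (\<Sum>v\<in>U. 2 * N - 1) + 2 * (\<Sum>v\<in>U. int (k v)) - N * links m U U"
      unfolding pot_def by (simp add: sum.distrib sum_distrib_left)
    ultimately have "pot N m k U - 2 * (N * links m U MS) \<le> pot N m' k' U" using le by linarith
    moreover have "pot N m k (S \<union> U) = pot N m k S + pot N m k U - 2 * N * links m S U"
      using pot_Un[OF m finS(1) finU] by simp
    moreover have "links m S U = links m U MS + links m U FS"
      using links_Un_right[of MS FS m U] SE finS links_sym[OF m, of S U] by simp
    ultimately show ?thesis by (simp add: algebra_simps)
  qed
  have "sparse N m' k' (insert r Q)"
    unfolding sparse_def
  proof (intro conjI ballI allI impI)
    show "finite (insert r Q)" using finS by simp
    show "int (k' v) \<le> N" if "v \<in> insert r Q" for v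
      using that kN N S r unfolding k'_def Q_def by auto
    fix U assume U: "U \<subseteq> insert r Q" "U \<noteq> {}"
    show "-1 \<le> pot N m' k' U"
    proof (cases "r \<in> U")
      case False
      then have UQ: "U \<subseteq> Q" using U by auto
      \<comment> \<open>Without \<open>r\<close>, a set that sees \<open>FS\<close> may have lost
        \<open>2 N\<close>, but each of its edges to \<open>FS\<close> returns that much.\<close>
      have "0 < links m U FS \<Longrightarrow> 2 * N * 1 \<le> 2 * N * links m U FS" using N by (intro mult_left_mono) auto
      moreover have "0 \<le> 2 * N * links m U FS" using N by simp
      ultimately show ?thesis using potW[OF UQ] W[of U] UQ U unfolding Q_def FS_def
        by (auto split: if_splits)
    next
      case True
      define U' where "U' = U - {r}"
      have U'3: "U = insert r U'" "r \<notin> U'" "U' \<subseteq> Q"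
        using U True unfolding U'_def by auto
      note U' = U'3 finite_subset[OF U'3(3) finS(2)]
      \<comment> \<open>As a vertex of capacity 0, \<open>r\<close> contributes
        \<open>2 N - 1\<close>, which turns the worst permitted loss \<open>2 N\<close> into exactly
        -1.\<close>
      have "pot N m' k' U = pot N m' k' U' + (2 * N - 1) - 2 * N * links m' {r} U'"
        using pot_insert[OF m' U'(4,2), of N k'] U' by (simp add: k'_def)
      moreover have "links m' {r} U' = links m U' FS"
        unfolding links_singleton_left[of m' r U'] links_sum_left[of m U' FS] using U' eqr by (intro sum.cong) auto
      moreover have "- 2 * N \<le> pot N m k (S \<union> U') - pot N m k S"
      proof (cases "U' = {}")
        case False then show ?thesis using W[of U'] U' N unfolding Q_def FS_def by (auto split: if_splits)
      qed (use N in simp)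
      ultimately show ?thesis using potW[OF U'(3)] by simp
    qed
  qed
  moreover have "card (insert r Q) \<le> card (V - S) + 1" using finS rQ unfolding Q_def by simp
  ultimately obtain M' where M': "col m' k' (insert r Q) M'" using IH m' by blast
  have cap: "links m' {v} M' < int (k' v)" if "v \<in> M'" for v using M' that unfolding col_def by auto
  have "r \<notin> M'" using cap[of r] links_nonneg[of m' "{r}" M'] by (auto simp: k'_def)
  then have M'Q: "M' \<subseteq> Q" using M' unfolding col_def by auto
  have finM': "finite M'" using M'Q finS finite_subset by blast
  have no: "links m {v} MS = 0" if "v \<in> M'" for v
    using cap[OF that] links_not_pos[of m "{v}" MS] unfolding k'_def by (auto split: if_splits)
  have cross: "links m M' MS = 0" unfolding links_sum_left[of m M' MS] using no by simp
  then have cross': "links m MS M' = 0" using links_sym[OF m] by simp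
  have disj: "MS \<inter> M' = {}" using MSS M'Q SQ by auto
  have "acyc m M'" using M' M'Q eqB acyc_cong[of M' m' m] unfolding col_def by blast
  then have aM: "acyc m (MS \<union> M')"
    using acyc_Un[OF m finS(3) finM' disj] MS cross' unfolding col_def by auto
  have "insert r Q - M' = insert r (Q - M')" using \<open>r \<notin> M'\<close> by auto
  then have "acyc m' (insert r (Q - M'))" using M' unfolding col_def by simp
  moreover have "acyc m FS" using MS unfolding col_def FS_def by simp
  ultimately have "acyc m (FS \<union> (Q - M'))"
    using m m' finS rQ SQ eqB eqr by (intro acyc_uncontract[of m FS "Q - M'" r m']) (auto simp: FS_def)
  moreover have "FS \<union> (Q - M') = V - (MS \<union> M')"
    using SE SQ M'Q S MSS unfolding Q_def by auto
  ultimately have aF: "acyc m (V - (MS \<union> M'))" by simp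
  have caps: "links m {v} (MS \<union> M') < int (k v)" if "v \<in> MS \<union> M'" for v
  proof -
    have eq: "links m {v} (MS \<union> M') = links m {v} MS + links m {v} M'"
      using links_Un_right[OF finS(3) finM' disj] .
    show ?thesis
    proof (cases "v \<in> MS")
      case True
      then have "links m {v} M' \<le> links m MS M'" using finS finM' by (intro links_mono) auto
      then have "links m {v} M' = 0" using cross' links_nonneg[of m "{v}" M'] by linarith
      then show ?thesis using eq MS True unfolding col_def by auto
    next
      case False
      then have v: "v \<in> M'" using that by auto
      have "links m {v} M' = links m' {v} M'" using v M'Q eqB[symmetric] by (intro links_cong) auto
      then show ?thesis using eq no[OF v] cap[OF v] unfolding k'_def by (auto split: if_splits)
    qed
  qed
  have "col m k V (MS \<union> M')"
    unfolding col_def using aM aF caps S MSS M'Q unfolding Q_def by auto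
  moreover have "(MS \<union> M') \<inter> S = MS" "(MS \<union> M') - S = M'" using MSS M'Q SQ by auto
  ultimately show ?thesis using that cross' by simp
qed

section \<open>Subsets of a minimal counterexample\<close>

definition add_edge :: "('v \<Rightarrow> 'v \<Rightarrow> nat) \<Rightarrow> 'v \<Rightarrow> 'v \<Rightarrow> 'v \<Rightarrow> 'v \<Rightarrow> nat" where
  "add_edge m x y = (\<lambda>u v. m u v + of_bool ({u, v} = {x, y}))"

lemma multiplicity_add_edge:
  "multiplicity_fun m \<Longrightarrow> x \<noteq> y \<Longrightarrow> multiplicity_fun (add_edge m x y)"
  unfolding multiplicity_fun_def add_edge_def by (simp add: insert_commute)

lemma links_add_edge:
  assumes "finite A" "finite B" "x \<noteq> y"
  shows "links (add_edge m x y) A B =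
    links m A B + of_bool (x \<in> A \<and> y \<in> B) + of_bool (y \<in> A \<and> x \<in> B)"
proof -
  have eq: "int (add_edge m x y u v) = int (m u v) + of_bool (u = x) * of_bool (v = y) + of_bool (u = y) * of_bool (v = x)"
    for u v using assms(3) unfolding add_edge_def doubleton_eq_iff by (simp add: of_bool_def)
  have s: "(\<Sum>u\<in>A. \<Sum>v\<in>B. of_bool (u = a) * of_bool (v = b) :: int) = of_bool (a \<in> A \<and> b \<in> B)" for a b
    unfolding sum_distrib_left[symmetric] sum_distrib_right[symmetric] using assms(1,2)
    by (simp add: of_bool_def if_distrib cong: if_cong)
  show ?thesis unfolding links_def eq by (simp add: sum.distrib s)
qed

lemma pot_add_edge:
  assumes "finite S" "x \<noteq> y"
  shows "pot N (add_edge m x y) k S = pot N m k S - 2 * N * of_bool (x \<in> S \<and> y \<in> S)"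
  unfolding pot_def links_add_edge[OF assms(1,1,2)] by (auto simp: algebra_simps)

text \<open>
  If \<open>x\<close> can take another neighbour in \<open>M\<close>, the edge \<open>x y\<close> may be deleted at the price of only one
  unit of the capacity of \<open>y\<close>. It is then the only edge between the two parts of \<open>M\<close>, so it closes
  no cycle.
\<close>

lemma extend_coloring_slack:
  fixes m :: "'v \<Rightarrow> 'v \<Rightarrow> nat"
  assumes m: "multiplicity_fun m" and N: "1 \<le> N" and fin: "finite V"
    and kN: "\<And>v. v \<in> V \<Longrightarrow> int (k v) \<le> N" and S: "S \<subseteq> V" "S \<noteq> {}" and MS: "col m k S MS"
    and IH: "\<And>(m' :: 'v \<Rightarrow> 'v \<Rightarrow> nat) k' V'. multiplicity_fun m' \<Longrightarrow> sparse N m' k' V' \<Longrightarrow>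
      card V' \<le> card (V - S) + 1 \<Longrightarrow> \<exists>M. col m' k' V' M"
    and x: "x \<in> MS" "links m {x} MS + 1 < int (k x)" and y: "y \<in> V - S" "0 < m x y"
    and W: "\<And>W. W \<subseteq> V - S \<Longrightarrow> W \<noteq> {} \<Longrightarrow>
      pot N m k S - (if y \<in> W then 2 * N - 1 else 1) \<le> pot N m k (S \<union> W)"
  shows "\<exists>M. col m k V M"
proof -
  define m1 where "m1 = (\<lambda>u v. m u v - of_bool ({u, v} = {x, y}))"
  define k1 where "k1 = k(y := k y - 1)"
  have xS: "x \<in> S" using x MS unfolding col_def by auto
  have xy: "x \<noteq> y" "y \<notin> S" using xS y by auto
  have "0 < m y x" using y(2) multiplicity_sym[OF m, of y x] by metis
  have ge: "of_bool ({u, v} = {x, y}) \<le> m u v" for u v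
  proof (cases "{u, v} = {x, y}")
    case True
    then have "0 < m u v" using y(2) \<open>0 < m y x\<close> by (metis doubleton_eq_iff)
    then show ?thesis by (simp add: of_bool_def)
  qed simp
  have "m u v = add_edge m1 x y u v" for u v
    unfolding add_edge_def m1_def using ge[of u v] by (rule le_add_diff_inverse2[symmetric])
  then have m_eq: "m = add_edge m1 x y" by blast
  have m1: "multiplicity_fun m1" using m unfolding multiplicity_fun_def m1_def by (simp add: insert_commute)
  have eq: "m1 u v = m u v" if "u \<noteq> y" "v \<noteq> y" for u v
    using that unfolding m1_def doubleton_eq_iff by simp
  have eqx: "m1 u v = m u v" if "u \<noteq> x" "v \<noteq> x" for u v
    using that unfolding m1_def doubleton_eq_iff by simp
  have finS: "finite S" using S fin finite_subset by auto
  have MSS: "MS \<subseteq> S" using MS unfolding col_def by auto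
  have ny: "\<And>u. u \<in> MS \<Longrightarrow> u \<noteq> y" using MSS xy by auto
  have eqS: "\<And>u v. u \<in> S \<Longrightarrow> v \<in> S \<Longrightarrow> m1 u v = m u v" using eq xy by metis
  have colS: "col m1 k1 S MS"
  proof -
    have "acyc m1 MS" "acyc m1 (S - MS)"
      using MS MSS acyc_cong[of MS m1 m] acyc_cong[of "S - MS" m1 m] eqS unfolding col_def by blast+
    moreover have "links m1 {v} MS = links m {v} MS" if "v \<in> MS" for v
      using that eqS MSS by (intro links_cong) auto
    ultimately show ?thesis using MS ny unfolding col_def k1_def by auto
  qed
  have "(\<Sum>v\<in>S. int (k v) - int (k1 v)) = 0"
    unfolding k1_def using xy by (intro sum.neutral) auto
  then have potS: "pot N m1 k1 S = pot N m k S"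
    using pot_add_edge[OF finS xy(1), of N m1 k] xy m_eq pot_caps_diff[of N m1 k1 S k]
    by auto
  \<comment> \<open>Deleting the edge gains \<open>2 N\<close>, and the unit of capacity taken from
    \<open>y\<close> costs at most 2.\<close>
  have potSW: "pot N m k (S \<union> W) + (if y \<in> W then 2 * N - 2 else 0) \<le> pot N m1 k1 (S \<union> W)"
    if "W \<subseteq> V - S" for W
  proof -
    have finW: "finite (S \<union> W)" using that finS fin finite_subset by blast
    have "pot N m k (S \<union> W) = pot N m1 k (S \<union> W) - 2 * N * of_bool (y \<in> W)"
      using pot_add_edge[OF finW xy(1), of N m1 k] xy xS m_eq by auto
    moreover have "(\<Sum>v\<in>S \<union> W. int (k v) - int (k1 v)) = (\<Sum>v\<in>S \<union> W. if v = y then int (k y) - int (k y - 1) else 0)"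
      unfolding k1_def by (intro sum.cong) auto
    then have "(\<Sum>v\<in>S \<union> W. int (k v) - int (k1 v)) \<le> of_bool (y \<in> W)"
      using finW xy by (auto simp: sum.delta)
    ultimately show ?thesis using pot_caps_diff[of N m1 k1 "S \<union> W" k] by auto
  qed
  obtain M where M: "col m1 k1 V M" "M \<inter> S = MS" "links m1 MS (M - S) = 0"
  proof (rule extend_coloring[OF m1 N fin _ S colS IH])
    show "int (k1 v) \<le> N" if "v \<in> V" for v using kN[OF that] unfolding k1_def by auto
    show "pot N m1 k1 S - (if 0 < links m1 W (S - MS) then 2 * N else 1) \<le> pot N m1 k1 (S \<union> W)"
      if "W \<subseteq> V - S" "W \<noteq> {}" for W
      using W[OF that] potSW[OF that(1)] potS N by (auto split: if_splits)
  qed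
  have finM: "finite M" "finite MS" "finite (M - S)"
    using M fin MSS finS finite_subset unfolding col_def by (meson finite_subset finite_Diff)+
  have Meq: "M = MS \<union> (M - S)" "MS \<inter> (M - S) = {}" using M MSS by auto
  have xM: "x \<in> M" using x Meq by auto
  have "acyc m (V - M)"
  proof -
    have "m1 u v = m u v" if "u \<in> V - M" "v \<in> V - M" for u v
      using that xM by (intro eqx) auto
    then show ?thesis using M acyc_cong[of "V - M" m1 m] unfolding col_def by blast
  qed
  moreover have "acyc m M"
  proof -
    have "acyc m1 (M - S)" using M acyc_subset[of m1 M "M - S"] unfolding col_def by auto
    moreover have "m1 u v = m u v" if "u \<in> M - S" "v \<in> M - S" for u v
      using that xS by (intro eqx) auto
    ultimately have "acyc m (M - S)" using acyc_cong[of "M - S" m1 m] by blast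
    moreover have "links m MS (M - S) \<le> 1"
      unfolding m_eq links_add_edge[OF finM(2,3) xy(1)] using M(3) ny xS by auto
    ultimately have "acyc m (MS \<union> (M - S))"
      using acyc_Un[OF m finM(2,3) Meq(2)] MS unfolding col_def by auto
    then show ?thesis using Meq by simp
  qed
  moreover have "links m {v} M < int (k v)" if v: "v \<in> M" for v
  proof -
    have l: "links m {v} M = links m1 {v} M + of_bool (v = x \<and> y \<in> M) + of_bool (v = y \<and> x \<in> M)"
      using links_add_edge[of "{v}" M x y m1] finM xy m_eq by auto
    have b: "links m1 {v} M < int (k1 v)" using M v unfolding col_def by auto
    consider "v = x" | "v = y" | "v \<noteq> x" "v \<noteq> y" by auto
    then show ?thesis
    proof cases
      case 1
      have "links m1 {x} (M - S) \<le> links m1 MS (M - S)" using x finM by (intro links_mono) auto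
      then have "links m1 {x} (M - S) = 0" using M(3) links_nonneg[of m1 "{x}" "M - S"] by linarith
      moreover have "links m1 {x} M = links m1 {x} MS + links m1 {x} (M - S)"
        using links_Un_right[OF finM(2,3) Meq(2)] Meq(1) by metis
      moreover have "links m1 {x} MS = links m {x} MS" using eqS xS MSS by (intro links_cong) auto
      ultimately show ?thesis using l x 1 xy by auto
    next
      \<comment> \<open>Truncation does no harm: a vertex \<open>y\<close> in \<open>M\<close> has
        \<open>k1 y > 0\<close>, so the unit was really taken and now pays for the restored
        edge.\<close>
      case 2
      then show ?thesis using l b xy links_nonneg[of m1 "{v}" M] unfolding k1_def
        by (cases "k y") auto
    next
      case 3
      then show ?thesis using l b unfolding k1_def by auto
    qed
  qed
  ultimately show ?thesis using M unfolding col_def by auto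
qed

lemma finite_minimizer:
  fixes f :: "'a \<Rightarrow> int"
  assumes "finite A" "A \<noteq> {}"
  obtains a where "a \<in> A" "\<And>b. b \<in> A \<Longrightarrow> f a \<le> f b"
proof -
  have "Min (f ` A) \<in> f ` A" using assms by auto
  then obtain a where a: "a \<in> A" "f a = Min (f ` A)" by auto
  then show ?thesis using that[of a] assms by auto
qed

lemma col_mono_caps:
  "col m k S M \<Longrightarrow> (\<And>v. v \<in> M \<Longrightarrow> k v \<le> k' v) \<Longrightarrow> col m k' S M"
  unfolding col_def by fastforce

locale min_counterexample =
  fixes N :: int and m :: "'v \<Rightarrow> 'v \<Rightarrow> nat" and k :: "'v \<Rightarrow> nat" and V :: "'v set"
  assumes m: "multiplicity_fun m" and N2: "2 \<le> N" and sp: "sparse N m k V"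
    and uncol: "\<And>M. \<not> col m k V M"
    and IH: "\<And>(m' :: 'v \<Rightarrow> 'v \<Rightarrow> nat) k' V'. multiplicity_fun m' \<Longrightarrow> sparse N m' k' V' \<Longrightarrow>
      card V' < card V \<Longrightarrow> \<exists>M. col m' k' V' M"
begin

lemma fin: "finite V" using sp unfolding sparse_def by simp

lemma fin_sub: "S \<subseteq> V \<Longrightarrow> finite S" using fin finite_subset by auto

lemma kN: "v \<in> V \<Longrightarrow> int (k v) \<le> N" using sp unfolding sparse_def by simp

lemma pot_ge: "S \<subseteq> V \<Longrightarrow> S \<noteq> {} \<Longrightarrow> -1 \<le> pot N m k S" using sp unfolding sparse_def by simp

text \<open>Take \<open>S0\<close> of least potential. Proper supersets are then harmless, and only
  \<open>V\<close> can fall lower, down to -1. So an extension succeeds if some end in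
  \<open>S0\<close> of an edge leaving \<open>S0\<close> is in \<open>F\<close>, where a loss of
  \<open>2 N\<close> is allowed, or has slack in \<open>M\<close>, where a loss of
  \<open>2 N - 1\<close> is. Such a colouring is forced by lowering the capacity of one such
  \<open>x\<close>: by one unit if the potential is at most \<open>2 N - 2\<close>, and to 0 if it
  is \<open>2 N - 1\<close>, which pays for all \<open>k x \<le> N\<close> units. With two vertices
  in \<open>S0\<close>, contraction makes the graph smaller.\<close>

lemma pot_proper:
  assumes "S \<subset> V" "2 \<le> card S"
  shows "2 * N \<le> pot N m k S"
proof (rule ccontr)
  assume less: "\<not> 2 * N \<le> pot N m k S"
  define A where "A = {S. S \<subset> V \<and> 2 \<le> card S}"
  have "A \<subseteq> Pow V" unfolding A_def by auto
  then have "finite A" using fin finite_subset by blast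
  moreover have "S \<in> A" using assms unfolding A_def by simp
  ultimately obtain S0 where S0: "S0 \<in> A" and min: "\<And>T. T \<in> A \<Longrightarrow> pot N m k S0 \<le> pot N m k T"
    using finite_minimizer[of A "pot N m k"] by auto
  have p: "pot N m k S0 \<le> 2 * N - 1" using min[OF \<open>S \<in> A\<close>] less by simp
  have S0V: "S0 \<subset> V" "2 \<le> card S0" using S0 unfolding A_def by auto
  then have S0V': "S0 \<subseteq> V" "S0 \<noteq> {}" by auto
  have pV: "-1 \<le> pot N m k V" using pot_ge[of V] S0V by auto
  have finS0: "finite S0" using fin_sub S0V by auto
  have cS: "card (V - S0) + 1 < card V"
    using S0V card_Diff_subset[OF finS0 S0V'(1)] card_mono[OF fin S0V'(1)] by linarith
  have min': "pot N m k S0 \<le> pot N m k (S0 \<union> W)" if "W \<subseteq> V - S0" "S0 \<union> W \<noteq> V" for W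
  proof -
    have "card S0 \<le> card (S0 \<union> W)" using that fin_sub[of "S0 \<union> W"] S0V by (intro card_mono) auto
    then show ?thesis using min[of "S0 \<union> W"] that S0V unfolding A_def by auto
  qed
  have IH': "\<And>(m' :: 'v \<Rightarrow> 'v \<Rightarrow> nat) k' V'. multiplicity_fun m' \<Longrightarrow> sparse N m' k' V' \<Longrightarrow>
      card V' \<le> card (V - S0) + 1 \<Longrightarrow> \<exists>M. col m' k' V' M" using IH cS by (meson le_less_trans)
  have no_ext: False
    if c: "col m k S0 M0" and b: "pot N m k S0 - (if 0 < links m (V - S0) (S0 - M0) then 2 * N else 1) \<le> -1" for M0
  proof -
    obtain M where "col m k V M"
    proof (rule extend_coloring[OF m _ fin kN S0V' c IH'])
      show "1 \<le> N" using N2 by simp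
      show "pot N m k S0 - (if 0 < links m W (S0 - M0) then 2 * N else 1) \<le> pot N m k (S0 \<union> W)"
        if W: "W \<subseteq> V - S0" "W \<noteq> {}" for W
      proof (cases "S0 \<union> W = V")
        case True
        then have "W = V - S0" using W by auto
        then show ?thesis using b pV True by (auto split: if_splits)
      next
        case False
        then show ?thesis using min'[OF W(1)] N2 by (smt (verit))
      qed
    qed
    then show False using uncol by auto
  qed
  have "sparse N m k S0" using sp sparse_subset S0V' by blast
  then obtain M0 where M0: "col m k S0 M0" using IH[OF m] psubset_card_mono[OF fin S0V(1)] by auto
  \<comment> \<open>At potential 0 or less the allowance 1 is enough, and every colouring of
    \<open>S0\<close> would extend.\<close>
  have p1: "1 \<le> pot N m k S0" using no_ext[OF M0] N2 by (smt (verit))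
  have "\<exists>x\<in>S0. \<exists>y\<in>V - S0. 0 < m x y"
  proof (rule ccontr)
    assume "\<not> ?thesis"
    then have l0: "links m S0 (V - S0) = 0" using links_pos_iff[of S0 "V - S0" m] finS0 fin
        links_not_pos[of m S0 "V - S0"] by auto
    obtain M where "col m k V M"
    proof (rule extend_coloring[OF m _ fin kN S0V' M0 IH'])
      show "1 \<le> N" using N2 by simp
      show "pot N m k S0 - (if 0 < links m W (S0 - M0) then 2 * N else 1) \<le> pot N m k (S0 \<union> W)"
        if W: "W \<subseteq> V - S0" "W \<noteq> {}" for W
      proof -
        have "links m S0 W \<le> links m S0 (V - S0)" using W fin finS0 by (intro links_mono) auto
        then have "links m S0 W = 0" using l0 links_nonneg[of m S0 W] by linarith
        moreover have "S0 \<inter> W = {}" "finite W" using W fin_sub by auto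
        ultimately have "pot N m k (S0 \<union> W) = pot N m k S0 + pot N m k W"
          using pot_Un[OF m finS0] by simp
        moreover have "-1 \<le> pot N m k W" using W pot_ge by blast
        ultimately show ?thesis using N2 by auto
      qed
    qed
    then show False using uncol by auto
  qed
  then obtain x y where xy: "x \<in> S0" "y \<in> V - S0" "0 < m x y" by auto
  \<comment> \<open>Afterwards \<open>x\<close> is in \<open>F\<close> or has a free slot in \<open>M\<close>, and the edge \<open>x y\<close> is cheap to replace.\<close>
  define j where "j = (if pot N m k S0 \<le> 2 * N - 2 then 1 else k x)"
  define k1 where "k1 = k(x := k x - j)"
  have k1le: "k1 v \<le> k v" for v unfolding k1_def by auto
  have "sparse N m k1 S0"
    unfolding sparse_def
  proof (intro conjI ballI allI impI)
    show "finite S0" by fact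
    show "int (k1 v) \<le> N" if "v \<in> S0" for v using kN[of v] k1le[of v] S0V' that by force
    fix T assume T: "T \<subseteq> S0" "T \<noteq> {}"
    have finT: "finite T" using T finS0 finite_subset by auto
    show "-1 \<le> pot N m k1 T"
    proof (cases "2 \<le> card T")
      case True
      have "(\<Sum>v\<in>T. int (k v) - int (k1 v)) = (\<Sum>v\<in>T. if v = x then int (k x) - int (k x - j) else 0)"
        unfolding k1_def by (intro sum.cong) auto
      also have "\<dots> \<le> int j" using finT by (auto simp: sum.delta)
      finally have "pot N m k T - 2 * int j \<le> pot N m k1 T" using pot_caps_diff[of N m k1 T k] by linarith
      moreover have "T \<in> A" using T True S0V unfolding A_def by auto
      then have "pot N m k S0 \<le> pot N m k T" by (rule min)
      moreover have "int (k x) \<le> N" using kN xy S0V' by auto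
      ultimately show ?thesis using p1 p N2 unfolding j_def by (auto split: if_splits)
    next
      case False
      moreover have "card T \<noteq> 0" using T finT by auto
      ultimately have "card T = 1" by linarith
      then obtain t where "T = {t}" using card_1_singletonE by blast
      then show ?thesis using pot_singleton[OF m, of N k1 t] N2 by simp
    qed
  qed
  then obtain M1 where M1: "col m k1 S0 M1" using IH[OF m] psubset_card_mono[OF fin S0V(1)] by blast
  then have M1k: "col m k S0 M1" using col_mono_caps k1le by blast
  show False
  proof (cases "x \<in> M1")
    case False
    have "0 < m y x" using xy multiplicity_sym[OF m, of y x] by metis
    then have "0 < links m (V - S0) (S0 - M1)"
      using links_pos_iff[of "V - S0" "S0 - M1" m] fin finS0 xy False by auto
    then show False using no_ext[OF M1k] p by simp
  next
    case True
    then have lk: "links m {x} M1 < int (k1 x)" using M1 unfolding col_def by auto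
    then have "0 < k1 x" using links_nonneg[of m "{x}" M1] by (cases "k1 x") auto
    then have j1: "j = 1" "pot N m k S0 \<le> 2 * N - 2" unfolding k1_def j_def by (auto split: if_splits)
    have "\<exists>M. col m k V M"
    proof (rule extend_coloring_slack[OF m _ fin kN S0V' M1k IH' True _ xy(2,3)])
      show "1 \<le> N" using N2 by simp
      show "links m {x} M1 + 1 < int (k x)" using lk j1 \<open>0 < k1 x\<close> unfolding k1_def by auto
      show "pot N m k S0 - (if y \<in> W then 2 * N - 1 else 1) \<le> pot N m k (S0 \<union> W)"
        if W: "W \<subseteq> V - S0" "W \<noteq> {}" for W
      proof (cases "S0 \<union> W = V")
        case True
        then have "y \<in> W" using W xy by auto
        then show ?thesis using True pV j1 by auto
      next
        case False
        then show ?thesis using min'[OF W(1)] N2 by auto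
      qed
    qed
    then show False using uncol by auto
  qed
qed

end

section \<open>Vertices of degree 3\<close>

lemma acyc_singleton: "multiplicity_fun m \<Longrightarrow> acyc m {v}"
  unfolding acyc_def by (auto simp: subset_singleton_iff links_singleton multiplicity_fun_def)

lemma acyc_insert:
  assumes "multiplicity_fun m" "finite F" "v \<notin> F" "acyc m F" "links m {v} F \<le> 1"
  shows "acyc m (insert v F)"
  using acyc_Un[of m "{v}" F] acyc_singleton[of m v] assms by simp

text \<open>In \<open>F\<close> the vertex \<open>v\<close> has at most one edge to each of
  \<open>x\<close> and \<open>y\<close>, so it subdivides the edge \<open>x y\<close> if both are
  present and is a leaf or isolated otherwise.\<close>

lemma acyc_insert_subdivide:
  assumes m: "multiplicity_fun m" and fin: "finite F" and v: "v \<notin> F" and xy: "x \<noteq> y"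
    and a: "acyc (add_edge m x y) F"
    and le: "\<And>u. u \<in> F \<Longrightarrow> m v u \<le> of_bool (u = x) + of_bool (u = y)"
  shows "acyc m (insert v F)"
  unfolding acyc_def
proof (intro allI impI)
  fix Y assume Y: "Y \<subseteq> insert v F" "Y \<noteq> {}"
  define Z where "Z = Y - {v}"
  have Z: "Z \<subseteq> F" "v \<notin> Z" using Y unfolding Z_def by auto
  have finZ: "finite Z" using Z fin finite_subset by auto
  have aZ: "links m Z Z + 2 * of_bool (x \<in> Z \<and> y \<in> Z) + 2 \<le> 2 * int (card Z)" if "Z \<noteq> {}"
  proof -
    have "links (add_edge m x y) Z Z = links m Z Z + 2 * of_bool (x \<in> Z \<and> y \<in> Z)"
      unfolding links_add_edge[OF finZ finZ xy] by (cases "x \<in> Z"; cases "y \<in> Z") simp_all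
    then show ?thesis using a Z that unfolding acyc_def by metis
  qed
  show "links m Y Y + 2 \<le> 2 * int (card Y)"
  proof (cases "v \<in> Y")
    case False
    then have "Z = Y" unfolding Z_def by simp
    then have "links m Y Y + 2 * of_bool (x \<in> Z \<and> y \<in> Z) + 2 \<le> 2 * int (card Y)" using aZ Y by metis
    then show ?thesis by (cases "x \<in> Z \<and> y \<in> Z") simp_all
  next
    case True
    then have YZ: "Y = insert v Z" unfolding Z_def by auto
    have "links m {v} Z \<le> (\<Sum>u\<in>Z. of_bool (u = x) + of_bool (u = y))"
      unfolding links_singleton_left using le Z by (intro sum_mono) force
    also have "\<dots> = of_bool (x \<in> Z) + of_bool (y \<in> Z)"
      using finZ by (simp add: sum.distrib of_bool_def)
    finally have vZ: "links m {v} Z \<le> of_bool (x \<in> Z) + of_bool (y \<in> Z)" .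
    have "links m Y Y = links m Z Z + 2 * links m {v} Z" "card Y = card Z + 1"
      using links_insert_self[OF m finZ Z(2)] YZ finZ Z by auto
    then show ?thesis using vZ aZ by (cases "Z = {}"; cases "x \<in> Z"; cases "y \<in> Z") simp_all
  qed
qed

text \<open>Only an inequality, because the subtraction of capacities may truncate at 0.\<close>

lemma pot_lower:
  "pot N m k T - 2 * (\<Sum>u\<in>T. int (t u)) \<le> pot N m (\<lambda>u. k u - t u) T"
proof -
  have "(\<Sum>u\<in>T. int (k u) - int (k u - t u)) \<le> (\<Sum>u\<in>T. int (t u))"
    by (intro sum_mono) auto
  then show ?thesis using pot_caps_diff[of N m "\<lambda>u. k u - t u" T k] by linarith
qed

section \<open>Degrees in a minimal counterexample\<close>

context min_counterexample
begin

lemma diag [simp]: "m v v = 0"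
  using m unfolding multiplicity_fun_def by simp

lemma links_self_singleton [simp]: "links m {v} {v} = 0"
  by (simp add: links_singleton)

lemma sparse_proper:
  assumes "S \<subset> V" "\<And>v. k1 v \<le> k v"
    and "\<And>T. T \<subseteq> S \<Longrightarrow> T \<noteq> {} \<Longrightarrow> -1 \<le> pot N m k1 T"
  obtains M where "col m k1 S M"
proof -
  have "sparse N m k1 S"
    unfolding sparse_def
  proof (intro conjI ballI allI impI)
    show "finite S" using assms fin_sub by auto
    show "int (k1 v) \<le> N" if "v \<in> S" for v using kN[of v] assms(1) assms(2)[of v] that by force
  qed (rule assms(3))
  then show ?thesis using that IH[OF m] psubset_card_mono[OF fin assms(1)] by blast
qed

lemma card_V: "2 \<le> card V"
proof (rule ccontr)
  assume "\<not> 2 \<le> card V"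
  then have c: "card V \<le> 1" by simp
  have "acyc m V"
    unfolding acyc_def
  proof (intro allI impI)
    fix Y assume Y: "Y \<subseteq> V" "Y \<noteq> {}"
    then have "card Y \<le> 1" "card Y \<noteq> 0" using c card_mono[OF fin Y(1)] fin_sub[OF Y(1)] by auto
    then have "card Y = 1" by linarith
    then obtain y where "Y = {y}" using card_1_singletonE by blast
    then show "links m Y Y + 2 \<le> 2 * int (card Y)" by simp
  qed
  then have "col m k V {}" unfolding col_def by simp
  then show False using uncol by auto
qed

lemma links_split:
  assumes "v \<in> V" "M \<subseteq> V - {v}"
  shows "links m {v} V = links m {v} M + links m {v} (V - {v} - M)"
proof -
  have "V = insert v (M \<union> (V - {v} - M))" using assms by auto
  then have "links m {v} V = links m {v} (insert v (M \<union> (V - {v} - M)))" by simp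
  also have "\<dots> = links m {v} (M \<union> (V - {v} - M))"
    using fin fin_sub[of M] assms by (subst links_insert_right) auto
  also have "\<dots> = links m {v} M + links m {v} (V - {v} - M)"
    using fin fin_sub[of M] assms by (intro links_Un_right) auto
  finally show ?thesis .
qed

text \<open>Otherwise \<open>v\<close> could join \<open>F\<close> without closing a cycle.\<close>

lemma forest_links:
  assumes "v \<in> V" "col m k (V - {v}) M"
  shows "2 \<le> links m {v} (V - {v} - M)"
proof (rule ccontr)
  assume "\<not> ?thesis"
  then have "acyc m (insert v (V - {v} - M))"
    using assms fin m unfolding col_def by (intro acyc_insert) auto
  moreover have "insert v (V - {v} - M) = V - M" using assms unfolding col_def by auto
  ultimately have "col m k V M" using assms unfolding col_def by auto
  then show False using uncol by auto
qed

text \<open>With at most one edge into \<open>M\<close>, \<open>v\<close> closes no cycle there, so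
  only a neighbour without room for \<open>v\<close> can keep it out of \<open>M\<close>.\<close>

lemma no_slack:
  assumes v: "v \<in> V" and M: "col m k (V - {v}) M" and l: "links m {v} M \<le> 1" "links m {v} M < int (k v)"
  obtains c where "c \<in> M" "0 < m v c" "int (k c) \<le> links m {c} M + int (m v c)"
proof (rule ccontr)
  assume n: "\<not> thesis"
  note ex = that
  have MV: "M \<subseteq> V - {v}" using M unfolding col_def by simp
  then have finM: "finite M" "v \<notin> M" using fin_sub[of M] by auto
  have "links m {c} M + int (m c v) < int (k c)" if c: "c \<in> M" for c
  proof (cases "0 < m v c")
    case True
    have "\<not> int (k c) \<le> links m {c} M + int (m v c)" using n ex c True by blast
    then show ?thesis using multiplicity_sym[OF m, of v c] by simp
  next
    case False
    then have "m c v = 0" using multiplicity_sym[OF m, of c v] by simp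
    then show ?thesis using M c unfolding col_def by auto
  qed
  then have "\<forall>c\<in>insert v M. links m {c} (insert v M) < int (k c)"
    using l finM by (auto simp: links_insert_right links_singleton add.commute)
  moreover have "acyc m (insert v M)" using acyc_insert[OF m finM] l M unfolding col_def by auto
  moreover have "V - insert v M = V - {v} - M" by auto
  ultimately have "col m k V (insert v M)" using M v MV unfolding col_def by auto
  then show False using uncol by auto
qed

lemma proper_minus: "v \<in> V \<Longrightarrow> V - {v} \<subset> V" by auto

lemma col_minus:
  assumes "v \<in> V"
  obtains M where "col m k (V - {v}) M"
  using sparse_proper[of "V - {v}" k thesis] proper_minus[OF assms] pot_ge by blast

text \<open>In a colouring of the other vertices two edges of \<open>v\<close> go to
  \<open>F\<close>; if \<open>v\<close> has positive capacity, another goes to \<open>M\<close>,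
  since \<open>v\<close> could join \<open>M\<close> if it had no neighbour there.\<close>

lemma min_degree:
  assumes "v \<in> V"
  shows "2 \<le> links m {v} V" "1 \<le> k v \<Longrightarrow> 3 \<le> links m {v} V"
proof -
  obtain M where M: "col m k (V - {v}) M" using col_minus[OF assms] .
  then have MV: "M \<subseteq> V - {v}" unfolding col_def by simp
  have s: "links m {v} V = links m {v} M + links m {v} (V - {v} - M)"
    using links_split[OF assms MV] .
  show "2 \<le> links m {v} V" using s forest_links[OF assms M] by (smt (verit) links_nonneg)
  assume k: "1 \<le> k v"
  have "1 \<le> links m {v} M"
  proof (rule ccontr)
    assume "\<not> ?thesis"
    then have 0: "links m {v} M = 0" using links_nonneg[of m "{v}" M] by linarith
    obtain c where "c \<in> M" "0 < m v c" using no_slack[OF assms M] 0 k by auto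
    moreover have "finite M" using fin_sub[of M] MV by auto
    ultimately show False using links_eq_0D[OF 0, of v c] by auto
  qed
  then show "3 \<le> links m {v} V" using s forest_links[OF assms M] by linarith
qed

text \<open>The loss is at most 2 per vertex of \<open>U\<close>, and \<open>pot_proper\<close>
  leaves \<open>2 N + 1\<close> above the threshold -1. Single vertices have potential at least
  \<open>2 N - 1\<close> whatever their capacity.\<close>

lemma lowered_col:
  assumes "v \<in> V" "finite U" "2 * int (card U) \<le> 2 * N + 1"
  obtains M where "col m (\<lambda>u. k u - of_bool (u \<in> U)) (V - {v}) M"
proof (rule sparse_proper[OF proper_minus[OF assms(1)]])
  fix T assume T: "T \<subseteq> V - {v}" "T \<noteq> {}"
  show "-1 \<le> pot N m (\<lambda>u. k u - of_bool (u \<in> U)) T"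
  proof (cases "2 \<le> card T")
    case True
    have finT: "finite T" using T fin_sub by auto
    have "(\<Sum>u\<in>T. int (of_bool (u \<in> U))) = int (card (T \<inter> U))"
      using finT by (simp add: of_bool_def if_distrib sum.If_cases Int_def cong: if_cong)
    moreover have "card (T \<inter> U) \<le> card U" using assms by (intro card_mono) auto
    moreover have "2 * N \<le> pot N m k T" using pot_proper[of T] T True assms by auto
    ultimately show ?thesis
      using pot_lower[of N m k T "\<lambda>u. of_bool (u \<in> U)"] assms(3) by linarith
  next
    case False
    moreover have "finite T" using T by (intro fin_sub) auto
    then have "card T \<noteq> 0" using T by auto
    ultimately have "card T = 1" by linarith
    then obtain t where "T = {t}" using card_1_singletonE by blast
    then show ?thesis using pot_singleton[OF m] N2 by simp
  qed
qed auto

text \<open>By \<open>min_degree\<close>, the only vertices whose charge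
  \<open>2 N - 1 + 2 k v - N deg v\<close> can be nonnegative.\<close>

definition "B = {v \<in> V. 2 \<le> k v \<and> links m {v} V = 3}"

text \<open>At least two of the three edges go to \<open>F\<close>, so the third goes to a saturated
  vertex \<open>c\<close>. A lowered vertex of \<open>M\<close> always keeps a spare unit of its
  true capacity, hence \<open>c\<close> is not in \<open>U\<close>.\<close>

lemma B_coloring:
  assumes v: "v \<in> B" and M: "col m (\<lambda>u. k u - of_bool (u \<in> U)) (V - {v}) M"
  obtains c where "c \<in> M" "c \<notin> U" "m v c = 1" "\<And>u. u \<in> M \<Longrightarrow> u \<noteq> c \<Longrightarrow> m v u = 0"
    "int (k c) \<le> links m {c} M + 1"
proof -
  have vV: "v \<in> V" "2 \<le> k v" "links m {v} V = 3" using v unfolding B_def by auto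
  have M': "col m k (V - {v}) M" using M col_mono_caps[of m _ "V - {v}" M k] by auto
  then have MV: "M \<subseteq> V - {v}" unfolding col_def by simp
  have finM: "finite M" using MV fin_sub by auto
  have l: "links m {v} M \<le> 1" using links_split[OF vV(1) MV] forest_links[OF vV(1) M'] vV by linarith
  obtain c where c: "c \<in> M" "0 < m v c" "int (k c) \<le> links m {c} M + int (m v c)"
    using no_slack[OF vV(1) M'] l vV by auto
  have "0 < links m {v} M" using c links_pos_iff[of "{v}" M m] finM by auto
  then have l1: "links m {v} M = 1" using l by linarith
  obtain c' where c': "c' \<in> M" "m v c' = 1" "\<And>u. u \<in> M \<Longrightarrow> u \<noteq> c' \<Longrightarrow> m v u = 0"
    using links_one_unique[OF l1 finM] by metis
  then have "c' = c" using c by force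
  moreover have "links m {c} M < int (k c - of_bool (c \<in> U))" using M c unfolding col_def by auto
  then have "c \<notin> U" using c(3) \<open>c' = c\<close> c'(2) by (cases "k c") auto
  ultimately show ?thesis using that[of c] c c' by auto
qed

text \<open>If all neighbours of positive capacity could be lowered, none of them could be the
  saturated neighbour of \<open>B_coloring\<close>. So twice their number exceeds
  \<open>2 N + 1\<close>; there are at most three, which forces \<open>N = 2\<close> and three
  distinct neighbours, joined by simple edges and all of positive capacity.\<close>

lemma B_props:
  assumes v: "v \<in> B"
  shows "N = 2" "k v = 2" "\<And>u. u \<in> V \<Longrightarrow> m v u \<le> 1" "\<And>u. u \<in> V \<Longrightarrow> 0 < m v u \<Longrightarrow> 1 \<le> k u"
    "card {u \<in> V. 0 < m v u} = 3"
proof -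
  have vV: "v \<in> V" "2 \<le> k v" "links m {v} V = 3" using v unfolding B_def by auto
  define nb where "nb = {u \<in> V. 0 < m v u}"
  define U where "U = {u \<in> nb. 0 < k u}"
  have finn: "finite nb" "finite U" "U \<subseteq> nb" using fin unfolding nb_def U_def by auto
  have "links m {v} nb = links m {v} V"
    unfolding links_singleton_left nb_def using fin by (intro sum.mono_neutral_left) auto
  then have s: "(\<Sum>u\<in>nb. int (m v u)) = 3" using vV links_singleton_left[of m v nb] by simp
  have ge1: "1 \<le> int (m v u)" if "u \<in> nb" for u using that unfolding nb_def by auto
  have le3: "int (card nb) \<le> 3" using sum_mono[of nb "\<lambda>_. 1" "\<lambda>u. int (m v u)"] ge1 s by simp
  have cU: "card U \<le> card nb" using finn by (intro card_mono) auto
  have "\<not> 2 * int (card U) \<le> 2 * N + 1"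
  proof
    assume "2 * int (card U) \<le> 2 * N + 1"
    then obtain M where M: "col m (\<lambda>u. k u - of_bool (u \<in> U)) (V - {v}) M"
      using lowered_col[OF vV(1) finn(2)] by blast
    obtain c where c: "c \<in> M" "c \<notin> U" "m v c = 1" using B_coloring[OF v M] by metis
    have "links m {c} M < int (k c - of_bool (c \<in> U))" "M \<subseteq> V" using M c unfolding col_def by auto
    then have "c \<in> U" using c unfolding U_def nb_def by (cases "k c") auto
    then show False using c by simp
  qed
  then have N: "N = 2" and "card U = 3" using le3 cU N2 by linarith+
  then have "card nb = 3" using le3 cU by linarith
  then show "card {u \<in> V. 0 < m v u} = 3" unfolding nb_def .
  have Unb: "U = nb" using finn \<open>card U = 3\<close> \<open>card nb = 3\<close> by (simp add: card_subset_eq)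
  show "N = 2" by fact
  show "k v = 2" using kN[OF vV(1)] N vV by linarith
  show "1 \<le> k u" if "u \<in> V" "0 < m v u" for u
  proof -
    have "u \<in> U" using that Unb unfolding nb_def by simp
    then show ?thesis unfolding U_def by simp
  qed
  have "(\<Sum>u\<in>nb. int (m v u) - 1) = 0" using s \<open>card nb = 3\<close> by (simp add: sum_subtractf)
  then have "\<forall>u\<in>nb. int (m v u) - 1 = 0" using sum_nonneg_eq_0_iff[of nb "\<lambda>u. int (m v u) - 1"] ge1 finn(1) by (metis diff_ge_0_iff_ge)
  then show "m v u \<le> 1" if "u \<in> V" for u using that unfolding nb_def by (cases "m v u = 0") auto
qed

text \<open>Lowering just the other two neighbours of \<open>v\<close> costs 4, which fits, and so
  the saturated neighbour must be \<open>c\<close>. One edge of \<open>c\<close> goes to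
  \<open>v\<close> and at least one to \<open>M\<close>, so at most one goes to \<open>F\<close>,
  and \<open>c\<close> can move there.\<close>

lemma B_independent:
  assumes v: "v \<in> B" and c: "c \<in> B"
  shows "m v c = 0"
proof (rule ccontr)
  assume n: "m v c \<noteq> 0"
  have vV: "v \<in> V" "2 \<le> k v" and cV: "c \<in> V" "2 \<le> k c" "links m {c} V = 3"
    using v c unfolding B_def by auto
  have vc: "v \<noteq> c" using n by auto
  define U where "U = {u \<in> V. 0 < m v u} - {c}"
  have "card U = 2" using B_props(5)[OF v] cV n fin unfolding U_def by auto
  then have "2 * int (card U) \<le> 2 * N + 1" "finite U" using N2 fin unfolding U_def by auto
  then obtain M where M: "col m (\<lambda>u. k u - of_bool (u \<in> U)) (V - {v}) M"
    using lowered_col[OF vV(1)] by blast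
  have Mk: "col m k (V - {v}) M" using M col_mono_caps[of m _ "V - {v}" M k] by auto
  then have MV: "M \<subseteq> V - {v}" unfolding col_def by simp
  have finM: "finite M" using MV fin_sub by auto
  obtain c' where c': "c' \<in> M" "c' \<notin> U" "m v c' = 1" "\<And>u. u \<in> M \<Longrightarrow> u \<noteq> c' \<Longrightarrow> m v u = 0"
    "int (k c') \<le> links m {c'} M + 1" using B_coloring[OF v M] by metis
  then have "c' = c" using MV unfolding U_def by auto
  note c' = c'[unfolded this]
  \<comment> \<open>Move \<open>v\<close> into \<open>M\<close> in place of its saturated neighbour \<open>c\<close>.\<close>
  define M' where "M' = insert v (M - {c})"
  have zero: "links m {v} (M - {c}) = 0" unfolding links_singleton_left using c'(4) by (intro sum.neutral) auto
  have vM: "v \<notin> M" using MV by auto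
  have "links m {c} V = links m {c} M + links m {c} (V - M)"
    using links_Un_right[of M "V - M" m "{c}"] finM fin MV by (metis Diff_disjoint Diff_partition finite_Diff order_trans subset_insertI2 Diff_subset)
  moreover have "V - M = insert v (V - {v} - M)" using vV vM by auto
  then have "links m {c} (V - M) = int (m c v) + links m {c} (V - {v} - M)"
    using fin by (simp add: links_insert_right links_singleton)
  moreover have "m c v = 1" using c'(3) multiplicity_sym[OF m, of c v] by metis
  ultimately have le1: "links m {c} (V - {v} - M) \<le> 1" using c'(5) cV by linarith
  have cF: "c \<notin> V - {v} - M" using c' by auto
  have "acyc m (insert c (V - {v} - M))"
    using acyc_insert[OF m _ cF _ le1] Mk fin unfolding col_def by auto
  moreover have "insert c (V - {v} - M) = V - M'" using cV vV vc c'(1) MV unfolding M'_def by auto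
  ultimately have "acyc m (V - M')" by simp
  moreover have "acyc m M'"
    unfolding M'_def using zero finM vM Mk acyc_subset[of m M "M - {c}"] unfolding col_def
    by (intro acyc_insert[OF m]) auto
  moreover have "links m {u} M' < int (k u)" if "u \<in> M'" for u
  proof (cases "u = v")
    case True
    then show ?thesis unfolding M'_def using zero vV finM vM by (simp add: links_insert_right)
  next
    case False
    then have u: "u \<in> M" "u \<noteq> c" using that unfolding M'_def by auto
    have "m u v = 0" using c'(4)[OF u] multiplicity_sym[OF m, of u v] by metis
    then have "links m {u} M' = links m {u} (M - {c})"
      unfolding M'_def using finM vM by (simp add: links_insert_right links_singleton)
    also have "\<dots> \<le> links m {u} M" using finM by (intro links_mono) auto
    finally show ?thesis using Mk u unfolding col_def by auto
  qed
  moreover have "M' \<subseteq> V" using vV MV unfolding M'_def by auto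
  ultimately have "col m k V M'" unfolding col_def by auto
  then show False using uncol by auto
qed

end

section \<open>Attaching vertices of degree 3 to a colouring of the rest\<close>

lemma acyc_attach:
  assumes m: "multiplicity_fun m" and A: "finite A" "acyc m A" and P: "finite P"
    and dis: "A \<inter> P = {}" and ind: "\<And>u v. u \<in> P \<Longrightarrow> v \<in> P \<Longrightarrow> m u v = 0"
    and le: "\<And>v. v \<in> P \<Longrightarrow> links m {v} A \<le> 1"
  shows "acyc m (A \<union> P)"
  using P dis ind le
proof (induction P rule: finite_induct)
  case empty
  then show ?case using A by simp
next
  case (insert v P)
  have 0: "links m {v} P = 0"
    unfolding links_singleton_left using insert.prems(2) by (intro sum.neutral) auto
  have "links m {v} (A \<union> P) = links m {v} A + links m {v} P"
    using A insert.hyps insert.prems by (intro links_Un_right) auto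
  then have "links m {v} (A \<union> P) \<le> 1" using insert.prems(3) 0 by simp
  moreover have "acyc m (A \<union> P)" using insert by auto
  ultimately show ?case using acyc_insert[OF m, of "A \<union> P" v] A insert.hyps insert.prems by auto
qed

context min_counterexample
begin

lemma B_sub: "B \<subseteq> V" unfolding B_def by auto

lemma finite_B: "P \<subseteq> B \<Longrightarrow> finite P" using B_sub fin_sub by (meson order_trans)

lemma links_B_B: "P \<subseteq> B \<Longrightarrow> P' \<subseteq> B \<Longrightarrow> links m P P' = 0"
  unfolding links_def using B_independent by (intro sum.neutral ballI) (auto intro: B_independent)

text \<open>For \<open>N = 2\<close> a vertex of \<open>B\<close> has capacity 2 and weight 3 + 4 =
  7, and an edge weighs 4.\<close>

lemma pot_Un_B:
  assumes "R \<subseteq> B" "Y \<subseteq> V" "R \<inter> Y = {}" "N = 2"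
  shows "pot N m k (Y \<union> R) = pot N m k Y + 7 * int (card R) - 4 * links m R Y"
proof -
  have "pot N m k R = (\<Sum>v\<in>R. 7)"
    unfolding pot_def links_B_B[OF assms(1,1)] assms(4) diff_0_right mult_zero_right
    using B_props(2) assms by (intro sum.cong) auto
  then have "pot N m k R = 7 * int (card R)" by simp
  moreover have "Y \<inter> R = {}" using assms by auto
  ultimately show ?thesis
    using pot_Un[OF m fin_sub[OF assms(2)] finite_B[OF assms(1)]] links_sym[OF m, of Y R] assms(4) by simp
qed

lemma links_B_rest:
  assumes v: "v \<in> P" "P \<subseteq> B" and c: "c \<in> V" "c \<notin> P" "m v c = 1"
  shows "links m {v} (V - P - {c}) = 2"
proof -
  define X where "X = V - P - {c}"
  have fX: "finite X" "finite P" using fin finite_B[OF v(2)] unfolding X_def by auto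
  have "V = insert c (X \<union> P)" using c v B_sub unfolding X_def by auto
  then have "links m {v} V = links m {v} (insert c (X \<union> P))" by simp
  also have "\<dots> = 1 + links m {v} (X \<union> P)"
    using fX c unfolding X_def by (subst links_insert_right) (auto simp: links_singleton)
  also have "links m {v} (X \<union> P) = links m {v} X + links m {v} P"
    using fX unfolding X_def by (intro links_Un_right) auto
  also have "links m {v} P = 0" using links_B_B[of "{v}" P] v by auto
  finally show ?thesis using v unfolding B_def X_def by auto
qed

text \<open>
  The vertex \<open>c\<close> goes to \<open>F\<close>. A vertex of \<open>P\<close> joins \<open>M\<close> if one of its two neighbours in \<open>X\<close> is in \<open>F\<close>,
  and otherwise hangs from \<open>c\<close> as a leaf of \<open>F\<close>, so \<open>P\<close> never closes a cycle through \<open>c\<close>.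
\<close>

lemma attach:
  assumes P: "P \<subseteq> B" and c: "c \<in> V" "c \<notin> P" "\<And>v. v \<in> P \<Longrightarrow> m v c = 1"
    and X: "X = V - P - {c}" and M: "M \<subseteq> X" "acyc m M" and F: "acyc m (insert c (X - M))"
    and cap: "\<And>u. u \<in> M \<Longrightarrow> links m {u} M + links m {u} P < int (k u)"
  shows False
proof -
  define PM where "PM = {v \<in> P. 0 < links m {v} (X - M)}"
  define PF where "PF = P - PM"
  have finX: "finite X" "finite M" "finite P" "finite PM" "finite PF"
    using fin M finite_B[OF P] finite_subset unfolding X PM_def PF_def by (auto intro: finite_subset)
  have sub: "PM \<subseteq> P" "PF \<subseteq> P" unfolding PM_def PF_def by auto
  have two: "links m {v} M + links m {v} (X - M) = 2" if "v \<in> P" for v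
  proof -
    have "links m {v} (M \<union> (X - M)) = links m {v} M + links m {v} (X - M)"
      using finX by (intro links_Un_right) auto
    moreover have "M \<union> (X - M) = X" using M by auto
    ultimately show ?thesis using links_B_rest[OF that P c(1,2) c(3)[OF that]] X by simp
  qed
  have ind: "m u v = 0" if "u \<in> P" "v \<in> P" for u v using B_independent that P by auto
  have leM: "links m {v} M \<le> 1" if "v \<in> PM" for v
    using two[of v] that unfolding PM_def by auto
  have aM: "acyc m (M \<union> PM)"
    using finX M X sub leM by (intro acyc_attach[OF m]) (auto intro: ind)
  have leF: "links m {v} (insert c (X - M)) \<le> 1" if "v \<in> PF" for v
  proof -
    have v: "v \<in> P" "\<not> 0 < links m {v} (X - M)" using that unfolding PF_def PM_def by auto
    have "links m {v} (insert c (X - M)) = int (m v c) + links m {v} (X - M)"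
      using finX X by (subst links_insert_right) (auto simp: links_singleton)
    then show ?thesis using v c(3) links_not_pos[of m "{v}" "X - M"] by simp
  qed
  have "acyc m (insert c (X - M) \<union> PF)"
    using finX F X sub leF c by (intro acyc_attach[OF m]) (auto intro: ind)
  moreover have "insert c (X - M) \<union> PF = V - (M \<union> PM)"
    using X sub c M B_sub P unfolding PF_def by auto
  ultimately have aF: "acyc m (V - (M \<union> PM))" by simp
  have "links m {u} (M \<union> PM) < int (k u)" if "u \<in> M \<union> PM" for u
  proof -
    have eq: "links m {u} (M \<union> PM) = links m {u} M + links m {u} PM"
      using finX M X sub by (intro links_Un_right) auto
    show ?thesis
    proof (cases "u \<in> M")
      case True
      have "links m {u} PM \<le> links m {u} P" using finX sub by (intro links_mono) auto
      then show ?thesis using eq cap[OF True] by simp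
    next
      case False
      then have u: "u \<in> PM" using that by auto
      then have "links m {u} PM = 0" using links_B_B[of "{u}" PM] sub P by auto
      moreover have "k u = 2" using B_props(2)[of u] u sub P by auto
      ultimately show ?thesis using eq leM[OF u] by simp
    qed
  qed
  then have "col m k V (M \<union> PM)" unfolding col_def using aM aF M X sub P B_sub by auto
  then show False using uncol by auto
qed

definition "hits P T i = {v \<in> P. links m {v} T = (i::int)}"

lemma hits_sub: "hits P T i \<subseteq> P" unfolding hits_def by auto

text \<open>Lower bounds for the potential of \<open>T\<close> come from enlarging it. A vertex with
  two edges into \<open>T\<close> changes the potential by 7 - 8 = -1, and the enlarged set is still
  proper, so it has potential at least 4. If \<open>c\<close> is added too, a vertex of
  \<open>hits P T 2\<close> changes it by 7 - 12 = -5 and one of \<open>hits P T 1\<close> by 7 - 8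
  = -1. The last premise makes this larger set proper as well.\<close>

lemma tally:
  assumes P: "P \<subseteq> B" and c: "c \<in> V" "c \<notin> P" "\<forall>v\<in>P. m v c = 1"
    and T: "T \<subseteq> V - P - {c}" and N: "N = 2"
  shows "links m P T = 2 * int (card (hits P T 2)) + int (card (hits P T 1))"
    and "card (hits P T 2) + card (hits P T 1) + card (hits P T 0) = card P"
    and "hits P T 2 \<noteq> {} \<or> hits P T 1 \<noteq> {} \<Longrightarrow> 4 + int (card (hits P T 2)) \<le> pot N m k T"
    and "pot N m k (insert c T \<union> (hits P T 2 \<union> hits P T 1)) = pot N m k T + 3 + 2 * int (k c)
      - 4 * links m {c} T - 5 * int (card (hits P T 2)) - int (card (hits P T 1))"
    and "hits P T 2 \<noteq> {} \<or> hits P T 1 \<noteq> {} \<Longrightarrow> hits P T 0 \<noteq> {} \<or> T \<noteq> V - P - {c} \<Longrightarrow>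
      1 - 2 * int (k c) + 4 * links m {c} T + 5 * int (card (hits P T 2)) + int (card (hits P T 1))
        \<le> pot N m k T"
proof -
  note c = c(1,2) c(3)[rule_format]
  let ?P0 = "hits P T 0" and ?P1 = "hits P T 1" and ?P2 = "hits P T 2"
  have finP: "finite P" using finite_B[OF P] .
  have fP: "finite ?P0" "finite ?P1" "finite ?P2" using finP unfolding hits_def by auto
  have TV: "T \<subseteq> V" "finite T" "c \<notin> T" "T \<inter> P = {}" using T fin_sub by auto
  have le2: "links m {v} T \<le> 2" if "v \<in> P" for v
    using links_B_rest[OF that P c(1,2) c(3)[OF that]] links_mono[of "{v}" "V - P - {c}" "{v}" T m] T fin by auto
  have Peq: "P = ?P2 \<union> ?P1 \<union> ?P0"
  proof -
    have "links m {v} T \<in> {0, 1, 2}" if "v \<in> P" for v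
      using le2[OF that] links_nonneg[of m "{v}" T]
      unfolding insert_iff empty_iff by linarith
    then show ?thesis unfolding hits_def by auto
  qed
  have dis: "?P2 \<inter> ?P1 = {}" "(?P2 \<union> ?P1) \<inter> ?P0 = {}" unfolding hits_def by auto
  have s2: "links m ?P2 T = 2 * int (card ?P2)"
    unfolding links_sum_left[of m ?P2 T] by (simp add: hits_def)
  have s1: "links m ?P1 T = int (card ?P1)"
    unfolding links_sum_left[of m ?P1 T] by (simp add: hits_def)
  have s0: "links m ?P0 T = 0"
    unfolding links_sum_left[of m ?P0 T] by (simp add: hits_def)
  have s12: "links m (?P2 \<union> ?P1) T = 2 * int (card ?P2) + int (card ?P1)"
    using links_Un_left[OF fP(3,2) dis(1), of m T] s1 s2 by simp
  have "links m P T = links m (?P2 \<union> ?P1) T + links m ?P0 T"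
    using links_Un_left[of "?P2 \<union> ?P1" ?P0 m T] fP dis Peq by simp
  then show 1: "links m P T = 2 * int (card ?P2) + int (card ?P1)" using s12 s0 by simp
  have c12: "card (?P2 \<union> ?P1) = card ?P2 + card ?P1" using card_Un_disjoint fP dis by metis
  then show 2: "card ?P2 + card ?P1 + card ?P0 = card P"
    using card_Un_disjoint[of "?P2 \<union> ?P1" ?P0] fP dis Peq by simp
  have 4: "pot N m k (insert c T \<union> (?P2 \<union> ?P1)) = pot N m k T + 3 + 2 * int (k c)
      - 4 * links m {c} T - 5 * int (card ?P2) - int (card ?P1)"
  proof -
    have sub: "?P2 \<union> ?P1 \<subseteq> B" "insert c T \<subseteq> V" "(?P2 \<union> ?P1) \<inter> insert c T = {}" "?P2 \<union> ?P1 \<subseteq> P"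
      using hits_sub[of P T 2] hits_sub[of P T 1] P TV c by blast+
    have "links m (?P2 \<union> ?P1) {c} = (\<Sum>v\<in>?P2 \<union> ?P1. 1)"
      unfolding links_def using sub c by (intro sum.cong) auto
    then have "links m (?P2 \<union> ?P1) {c} = int (card ?P2) + int (card ?P1)" using c12 by simp
    then have "links m (?P2 \<union> ?P1) (insert c T) = 3 * int (card ?P2) + 2 * int (card ?P1)"
      using s12 links_insert_right[OF TV(2,3), of m "?P2 \<union> ?P1"] by simp
    then show ?thesis using pot_Un_B[OF sub(1,2,3) N] pot_insert[OF m TV(2,3), of N k] c12 N by simp
  qed
  then show "pot N m k (insert c T \<union> (?P2 \<union> ?P1)) = pot N m k T + 3 + 2 * int (k c)
      - 4 * links m {c} T - 5 * int (card ?P2) - int (card ?P1)" .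
  assume ne: "?P2 \<noteq> {} \<or> ?P1 \<noteq> {}"
  have Tne: "T \<noteq> {}" using ne unfolding hits_def by auto
  have "4 \<le> pot N m k T"
  proof (cases "2 \<le> card T")
    case True
    then show ?thesis using pot_proper[of T] TV c N by auto
  next
    case False
    moreover have "card T \<noteq> 0" using TV Tne by auto
    ultimately have "card T = 1" by linarith
    then obtain t where t: "T = {t}" using card_1_singletonE by blast
    \<comment> \<open>A single vertex escapes \<open>pot_proper\<close>, but a neighbour of
      \<open>B\<close> has capacity at least 1 and so potential at least 5.\<close>
    obtain v where v: "v \<in> P" "0 < links m {v} T" using ne unfolding hits_def by auto
    then have "0 < m v t" using t by (simp add: links_singleton)
    then have "1 \<le> k t" using B_props(4)[of v t] v P t TV by auto
    then show ?thesis using t pot_singleton[OF m, of N k t] N by simp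
  qed
  then show "4 + int (card ?P2) \<le> pot N m k T"
  proof (cases "?P2 = {}")
    case False
    have sub: "?P2 \<subseteq> B" "T \<subseteq> V" "?P2 \<inter> T = {}" "?P2 \<subseteq> P"
      using hits_sub[of P T 2] P TV by blast+
    have "card (T \<union> ?P2) = card T + card ?P2" using sub TV fP by (intro card_Un_disjoint) auto
    moreover have "card T \<noteq> 0" "card ?P2 \<noteq> 0" using TV Tne fP False by auto
    ultimately have "2 \<le> card (T \<union> ?P2)" by linarith
    moreover have "T \<union> ?P2 \<subset> V" using sub c TV B_sub by blast
    ultimately have "4 \<le> pot N m k (T \<union> ?P2)" using pot_proper[of "T \<union> ?P2"] N by simp
    then show ?thesis using pot_Un_B[OF sub(1,2,3) N] s2 by simp
  qed simp
  assume "?P0 \<noteq> {} \<or> T \<noteq> V - P - {c}"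
  then have "insert c T \<union> (?P2 \<union> ?P1) \<noteq> V" using dis T hits_sub[of P T] B_sub P c by blast
  moreover have "insert c T \<union> (?P2 \<union> ?P1) \<subseteq> V" using hits_sub[of P T] B_sub P c TV by blast
  moreover have "2 \<le> card (insert c T \<union> (?P2 \<union> ?P1))"
  proof -
    have "2 \<le> card (insert c T)" using TV Tne card_gt_0_iff[of T] by auto
    also have "\<dots> \<le> card (insert c T \<union> (?P2 \<union> ?P1))" using TV fP by (intro card_mono) auto
    finally show ?thesis .
  qed
  ultimately have "4 \<le> pot N m k (insert c T \<union> (?P2 \<union> ?P1))" using pot_proper N by (metis mult_2 numeral_Bit0 psubsetI numeral_eq_iff mult_2_right)
  then show "1 - 2 * int (k c) + 4 * links m {c} T + 5 * int (card ?P2) + int (card ?P1) \<le> pot N m k T"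
    using 4 by linarith
qed

lemma links_P_right: "P \<subseteq> B \<Longrightarrow> (\<Sum>u\<in>T. links m {u} P) = links m P T"
  using links_sum_left[of m T P] links_sym[OF m, of T P] by simp

lemma obtain_B_nbrs:
  assumes "c \<in> V" "int n \<le> links m {c} B"
  obtains P where "P \<subseteq> B" "card P = n" "\<And>v. v \<in> P \<Longrightarrow> m v c = 1" "c \<notin> P" "links m {c} P = int n"
proof -
  have finB: "finite B" using finite_B by auto
  have "m c v = of_bool (0 < m v c)" if "v \<in> B" for v
    using B_props(3)[OF that assms(1)] multiplicity_sym[OF m, of c v] by (cases "m v c = 0") auto
  then have "links m {c} B = (\<Sum>v\<in>B. of_bool (0 < m v c))"
    unfolding links_singleton_left by (intro sum.cong) auto
  also have "\<dots> = int (card {v \<in> B. 0 < m v c})"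
    using finB by (simp add: of_bool_def sum.If_cases Int_def)
  finally have "n \<le> card {v \<in> B. 0 < m v c}" using assms by simp
  then obtain P where P: "P \<subseteq> {v \<in> B. 0 < m v c}" "card P = n"
    using obtain_subset_with_card_n by metis
  have one: "m v c = 1" if "v \<in> P" for v using P that B_props(3)[of v c] assms(1) by force
  have "links m {c} P = (\<Sum>v\<in>P. 1)"
    unfolding links_singleton_left using one multiplicity_sym[OF m] by (intro sum.cong) (metis of_nat_1)+
  then show ?thesis using that[of P] P one by fastforce
qed

text \<open>Each vertex of \<open>X\<close> reserves one unit of capacity for every edge to
  \<open>P\<close>, so whatever part of \<open>P\<close> joins \<open>M\<close> finds room;
  \<open>c\<close> is at most a leaf of \<open>F\<close>.\<close>

lemma attach_lowered:
  assumes P: "P \<subseteq> B" and c: "c \<in> V" "c \<notin> P" "\<And>v. v \<in> P \<Longrightarrow> m v c = 1"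
    and X: "X = V - P - {c}" and cX: "links m {c} X \<le> 1"
    and pos: "\<And>T. T \<subseteq> X \<Longrightarrow> T \<noteq> {} \<Longrightarrow> -1 \<le> pot N m k T - 2 * links m P T"
  shows False
proof -
  define k1 where "k1 = (\<lambda>u. k u - nat (links m {u} P))"
  have "-1 \<le> pot N m k1 T" if T: "T \<subseteq> X" "T \<noteq> {}" for T
    using pot_lower[of N m k T "\<lambda>u. nat (links m {u} P)"] links_P_right[OF P, of T] pos[OF T]
    unfolding k1_def by simp
  moreover have "X \<subset> V" using c unfolding X by auto
  ultimately obtain M where M: "col m k1 X M" using sparse_proper[of X k1] unfolding k1_def by auto
  have MX: "M \<subseteq> X" using M unfolding col_def by simp
  show False
  proof (rule attach[OF P c(1,2,3) X MX])
    show "acyc m M" using M unfolding col_def by simp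
    have "links m {c} (X - M) \<le> links m {c} X" using fin unfolding X by (intro links_mono) auto
    then show "acyc m (insert c (X - M))"
      using M cX fin unfolding col_def X by (intro acyc_insert[OF m]) auto
    show "links m {u} M + links m {u} P < int (k u)" if "u \<in> M" for u
    proof -
      have "links m {u} M < int (k u - nat (links m {u} P))" using M that unfolding col_def k1_def by auto
      then show ?thesis using links_nonneg[of m "{u}" M] links_nonneg[of m "{u}" P] by linarith
    qed
  qed
qed

text \<open>Two neighbours in \<open>B\<close> leave \<open>c\<close> a single edge to
  \<open>X\<close>, and then all demands of these two can be reserved at once.\<close>

lemma B_nbrs_of_1_3:
  assumes c: "c \<in> V" "k c = 1" "links m {c} V = 3"
  shows "links m {c} B \<le> 1"
proof (rule ccontr)
  assume "\<not> ?thesis"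
  then obtain P where P: "P \<subseteq> B" "card P = 2" "\<And>v. v \<in> P \<Longrightarrow> m v c = 1" "c \<notin> P" "links m {c} P = 2"
    using obtain_B_nbrs[OF c(1), of 2] by auto
  obtain v where "v \<in> P" using P(2) by fastforce
  then have N: "N = 2" using B_props(1) P by auto
  have finP: "finite P" using finite_B P by auto
  define X where "X = V - P - {c}"
  have "V = insert c (X \<union> P)" using c P B_sub unfolding X_def by auto
  then have "links m {c} V = links m {c} (insert c (X \<union> P))" by simp
  then have cX: "links m {c} X = 1"
    using links_insert_right[of "X \<union> P" c m "{c}"] links_Un_right[of X P m "{c}"] fin finP c P
    unfolding X_def by auto
  have pos: "-1 \<le> pot N m k T - 2 * links m P T" if T: "T \<subseteq> X" "T \<noteq> {}" for T
  proof -
    have Pc: "\<forall>v\<in>P. m v c = 1" using P(3) by blast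
    note t = tally[OF P(1) c(1) P(4) Pc T(1)[unfolded X_def] N]
    have potT: "-1 \<le> pot N m k T" using T pot_ge unfolding X_def by blast
    have full: "-1 \<le> pot N m k (insert c T \<union> (hits P T 2 \<union> hits P T 1))"
      using T hits_sub[of P T] P c B_sub unfolding X_def by (intro pot_ge) blast+
    let ?p = "card (hits P T 2)" and ?q = "card (hits P T 1)" and ?r = "card (hits P T 0)"
    have sum: "?p + ?q + ?r = 2" using t(2) P by simp
    show ?thesis
    proof (cases "hits P T 2 \<noteq> {} \<or> hits P T 1 \<noteq> {}")
      case False
      then show ?thesis using t(1) potT by simp
    next
      case True
      note t3 = t(3)[OF True]
      show ?thesis
      \<comment> \<open>The bound \<open>4 + p\<close> covers the required
        \<open>4 p + 2 q - 1\<close> except for \<open>p = 2\<close>. In that case the set enlarged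
        by \<open>c\<close> and \<open>P\<close> gives at least 8, where 7 is needed.\<close>
      proof (cases "?p = 2")
        case False
        then have "4 * int ?p + 2 * int ?q \<le> 5 + int ?p" using sum by linarith
        then show ?thesis using t(1) t3 by linarith
      next
        case p2: True
        show ?thesis
        proof (cases "T = X")
          case False
          then have "T \<noteq> V - P - {c}" unfolding X_def .
          from t(5)[OF True disjI2, OF this] show ?thesis
            using p2 sum t(1) c(2) links_nonneg[of m "{c}" T] by linarith
        next
          case True
          then show ?thesis using full t(4) p2 sum t(1) c(2) cX by simp
        qed
      qed
    qed
  qed
  show False using attach_lowered[OF P(1) c(1) P(4,3) X_def _ pos] cX by simp
qed

end

section \<open>Vertices of capacity 2 and degree 4: sets on which full lowering fails\<close>

lemma pot_cong_caps: "(\<And>v. v \<in> S \<Longrightarrow> k v = k' v) \<Longrightarrow> pot N m k S = pot N m k' S"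
  unfolding pot_def by simp

lemma links_le_add_edge: "links m X Y \<le> links (add_edge m x y) X Y"
  unfolding links_def add_edge_def by (intro sum_mono) simp

lemma add_edge_other: "u \<noteq> x \<Longrightarrow> v \<noteq> x \<Longrightarrow> add_edge m x y u v = m u v"
  unfolding add_edge_def doubleton_eq_iff by simp

context min_counterexample
begin

text \<open>
  Lowering capacities at all neighbours of \<open>P\<close> in \<open>X\<close> can only fail on the sets \<open>T\<close> described here.
\<close>

lemma deficient_set_hits:
  assumes P: "P \<subseteq> B" "card P = 3" "c \<notin> P" "\<forall>v\<in>P. m v c = 1" and c: "c \<in> V" "k c = 2"
    and X: "X = V - P - {c}" and x: "x \<in> X" "m c x = 1" "\<forall>u\<in>X. u \<noteq> x \<longrightarrow> m c u = 0"
    and T: "T \<subseteq> X" and bad: "pot N m k T - 2 * links m P T \<le> -2"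
  shows "hits P T 0 = {}" "hits P T 1 \<noteq> {}" "x \<in> T \<Longrightarrow> hits P T 2 = {}"
    "-3 \<le> pot N m k T - 2 * links m P T"
    "card (hits P T 2) + card (hits P T 1) = 3"
proof -
  obtain v where "v \<in> P" using P(2) by fastforce
  then have N: "N = 2" using B_props(1) P by auto
  have finP: "finite P" using finite_B P by auto
  note t = tally[OF P(1) c(1) P(3,4) T[unfolded X] N]
  let ?p = "card (hits P T 2)" and ?q = "card (hits P T 1)" and ?r = "card (hits P T 0)"
  have fh: "finite (hits P T i)" for i using finP unfolding hits_def by auto
  have z: "hits P T i = {} \<longleftrightarrow> card (hits P T i) = 0" for i using fh by simp
  have sum: "?p + ?q + ?r = 3" using t(2) P by simp
  have Tne: "T \<noteq> {}" using bad by auto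
  have finT: "finite T" using T X fin_sub[of T] by auto
  have potT: "-1 \<le> pot N m k T" using T X Tne pot_ge[of T] by blast
  have e: "links m {c} T = of_bool (x \<in> T)"
  proof -
    have "links m {c} T = (\<Sum>u\<in>T. of_bool (u = x))"
      unfolding links_singleton_left using x T by (intro sum.cong) auto
    then show ?thesis using finT by (simp add: of_bool_def)
  qed
  have full: "-1 \<le> pot N m k (insert c T \<union> (hits P T 2 \<union> hits P T 1))"
    using T hits_sub[of P T] P c B_sub unfolding X by (intro pot_ge) blast+
  have b: "pot N m k T - 2 * (2 * int ?p + int ?q) \<le> -2" using bad t(1) by simp
  have pq: "hits P T 2 \<noteq> {} \<or> hits P T 1 \<noteq> {}"
  proof (rule ccontr)
    assume "\<not> ?thesis"
    then have "?p = 0" "?q = 0" using z by auto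
    then show False using b potT by simp
  qed
  note t3 = t(3)[OF pq]
  have t5: "- 3 + 4 * of_bool (x \<in> T) + 5 * int ?p + int ?q \<le> pot N m k T" if "?r \<noteq> 0 \<or> T \<noteq> X"
    using t(5)[OF pq] that z[of 0] e c unfolding X by auto
  \<comment> \<open>If all hits are double, \<open>t3\<close> requires \<open>p \<ge> 2\<close>
    while \<open>t5\<close> requires \<open>p \<le> 1\<close>; for \<open>T = X\<close> the
    potential of all of \<open>V\<close> decides.\<close>
  have q0: "?q \<noteq> 0"
  proof
    assume q: "?q = 0"
    show False
    proof (cases "T = X")
      case False
      then show False using t5 q b sum t3 zero_le_numeral[where 'a = int, of num.One] by (cases "x \<in> T") auto
    next
      case True
      have "?r = 0"
      proof -
        have "links m {v} T = 2" if "v \<in> P" for v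
          using links_B_rest[OF that P(1) c(1) P(3)] P(4) that True X by auto
        then have "hits P T 0 = {}" unfolding hits_def by auto
        then show ?thesis by simp
      qed
      then have "?p = 3" using sum q by simp
      then show False using full t(4) c e True x b q by simp
    qed
  qed
  then show "hits P T 1 \<noteq> {}" by auto
  have TX: "T \<noteq> X"
  proof
    assume "T = X"
    then have "links m {v} T = 2" if "v \<in> P" for v
      using links_B_rest[OF that P(1) c(1) P(3)] P(4) that X by auto
    then have "hits P T 1 = {}" unfolding hits_def by auto
    then show False using q0 by simp
  qed
  have r0: "?r = 0"
  proof (rule ccontr)
    assume "?r \<noteq> 0"
    then have "?p = 0 \<or> ?p = 1" "?p + ?q \<le> 2" using sum q0 by linarith+
    then show False using t3 b by auto
  qed
  then show "hits P T 0 = {}" using z by simp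
  show s3: "?p + ?q = 3" using sum r0 by simp
  have t5': "- 3 + 4 * of_bool (x \<in> T) + 5 * int ?p + int ?q \<le> pot N m k T" using t5 TX by blast
  show "hits P T 2 = {}" if "x \<in> T"
  proof (rule ccontr)
    assume "hits P T 2 \<noteq> {}"
    then have "?p \<noteq> 0" using z by simp
    then show False using t5' that b s3 by simp
  qed
  \<comment> \<open>The lowered potential misses -1 by at most 2, the price of one unit of capacity.
    This is why it later suffices to spare the demand of one vertex of \<open>P\<close>.\<close>
  have "2 * (2 * int ?p + int ?q) - 3 \<le> pot N m k T"
  proof -
    consider "?p = 0" "?q = 3" | "?p = 1" "?q = 2" | "?p = 2" "?q = 1" using s3 q0 by linarith
    then show ?thesis
    proof cases
      case 1 then show ?thesis using t3 by simp
    next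
      case 2 then show ?thesis using t3 by simp
    next
      case 3 then show ?thesis using t5' by (cases "x \<in> T") simp_all
    qed
  qed
  then show "-3 \<le> pot N m k T - 2 * links m P T" using t(1) by simp
qed

text \<open>The one configuration that counting does not exclude. It is coloured directly: the edge
  \<open>c x\<close> becomes a component of \<open>M\<close>, and \<open>P\<close> hangs as leaves
  from the \<open>F\<close>-part of a colouring of \<open>T\<close>.\<close>

lemma deficient_set_single_exit:
  assumes P: "P \<subseteq> B" "c \<notin> P" and T: "T \<subseteq> V" "c \<notin> T" "x \<notin> T" "T \<inter> P = {}"
    and V: "V = insert x (insert c (T \<union> P))" and cx: "c \<noteq> x" "x \<notin> P" "m c x = 1" "k c = 2" "k x = 2"
    and l: "links m {c} T = 0" "links m {x} T = 0" "\<And>v. v \<in> P \<Longrightarrow> links m {v} T \<le> 1"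
  shows False
proof -
  have fT: "finite T" "finite P" using T fin_sub finite_B P by auto
  have "T \<subset> V" using V T by auto
  then obtain M0 where M0: "col m k T M0"
    using sparse_proper[of T k] pot_ge by (metis le_refl psubset_imp_subset order_trans)
  have M0T: "M0 \<subseteq> T" using M0 unfolding col_def by simp
  have fM: "finite M0" using M0T fT finite_subset by auto
  have z: "links m {c} M0 = 0" "links m {x} M0 = 0"
    using links_mono[OF _ fT(1) _ M0T, of "{c}" "{c}" m] links_mono[OF _ fT(1) _ M0T, of "{x}" "{x}" m]
      l links_nonneg[of m "{c}" M0] links_nonneg[of m "{x}" M0] by auto
  have nin: "c \<notin> M0" "x \<notin> M0" "c \<notin> insert x M0" using M0T T cx by auto
  define M where "M = insert c (insert x M0)"
  have lc: "links m {u} M = int (m u c) + int (m u x) + links m {u} M0" for u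
    unfolding M_def using fM nin links_insert_right[of "insert x M0" c m "{u}"]
      links_insert_right[of M0 x m "{u}"] by (simp add: links_singleton)
  have "acyc m (insert x M0)" using acyc_insert[OF m fM nin(2)] M0 z unfolding col_def by auto
  moreover have "links m {c} (insert x M0) = 1"
    using links_insert_right[OF fM nin(2), of m "{c}"] z cx by (simp add: links_singleton)
  ultimately have aM: "acyc m M" unfolding M_def using acyc_insert[OF m _ nin(3)] fM by auto
  have "acyc m ((T - M0) \<union> P)"
  proof (rule acyc_attach[OF m])
    show "links m {v} (T - M0) \<le> 1" if "v \<in> P" for v
      using links_mono[of "{v}" T "{v}" "T - M0" m] fT l(3)[OF that] by auto
    show "m u v = 0" if "u \<in> P" "v \<in> P" for u v using B_independent that P by auto
  qed (use fT M0 T in \<open>auto simp: col_def\<close>)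
  moreover have "(T - M0) \<union> P = V - M" using V T P cx M0T unfolding M_def by auto
  ultimately have aF: "acyc m (V - M)" by simp
  have "links m {u} M < int (k u)" if u: "u \<in> M" for u
  proof -
    consider "u = c" | "u = x" | "u \<in> M0" using u unfolding M_def by auto
    then show ?thesis
    proof cases
      case 1 then show ?thesis using lc[of c] z cx by simp
    next
      case 2
      have "m x c = 1" using multiplicity_sym[OF m, of x c] cx by simp
      then show ?thesis using 2 lc[of x] z cx by simp
    next
      case 3
      have "m c u = 0" "m x u = 0" using links_eq_0D[OF z(1) _ fM, of c u] links_eq_0D[OF z(2) _ fM, of x u] 3 by auto
      then have "m u c = 0" "m u x = 0" using multiplicity_sym[OF m, of u] by auto
      then show ?thesis using lc[of u] M0 3 unfolding col_def by auto
    qed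
  qed
  moreover have "M \<subseteq> V" using V M0T unfolding M_def by auto
  ultimately have "col m k V M" using aM aF unfolding col_def by auto
  then show False using uncol by auto
qed

text \<open>
  Every vertex in \<open>hits P T 1\<close> has one neighbour in \<open>T\<close> and one in \<open>X - T\<close>; the latter cannot be the
  remaining neighbour \<open>x\<close> of \<open>c\<close> for all of them.
\<close>

lemma not_all_exits_equal:
  assumes P: "P \<subseteq> B" "card P = 3" "c \<notin> P" "\<forall>v\<in>P. m v c = 1" and c: "c \<in> V" "k c = 2"
    and X: "X = V - P - {c}" and x: "x \<in> X" "m c x = 1" "\<forall>u\<in>X. u \<noteq> x \<longrightarrow> m c u = 0"
    and T: "T \<subseteq> X" and bad: "pot N m k T - 2 * links m P T \<le> -2"
    and xT: "x \<notin> T" and hx: "\<forall>v\<in>hits P T 1. m v x = 1"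
  shows False
proof -
  obtain v where "v \<in> P" using P(2) by fastforce
  then have N: "N = 2" using B_props(1) P by auto
  have finP: "finite P" using finite_B P by auto
  note a = deficient_set_hits[OF P c X x T bad]
  note t = tally[OF P(1) c(1) P(3,4) T[unfolded X] N]
  let ?p = "card (hits P T 2)" and ?q = "card (hits P T 1)"
  have fh: "finite (hits P T i)" for i using finP unfolding hits_def by auto
  have q0: "?q \<noteq> 0" using a(2) fh by auto
  have TV: "T \<subseteq> V" "c \<notin> T" "T \<inter> P = {}" using T X by auto
  have finT: "finite T" using TV fin_sub by auto
  have xV: "x \<in> V" "x \<notin> P" "x \<noteq> c" using x X by auto
  have cT: "links m {c} T = 0"
    unfolding links_singleton_left using x(3) T xT by (intro sum.neutral) auto
  have Psplit: "P = hits P T 2 \<union> hits P T 1"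
  proof -
    have "card (hits P T 2 \<union> hits P T 1) = card P"
      using a(5) P(2) fh by (subst card_Un_disjoint) (auto simp: hits_def)
    then show ?thesis using card_subset_eq[OF finP, of "hits P T 2 \<union> hits P T 1"] hits_sub[of P T] by simp
  qed
  have xc: "m x c = 1" using multiplicity_sym[OF m, of x c] x(2) by simp
  have x2: "links m {x} (hits P T 2) = 0"
  proof -
    have "m x v = 0" if v: "v \<in> hits P T 2" for v
    proof -
      have vP: "v \<in> P" "links m {v} T = 2" using v unfolding hits_def by auto
      have "links m {v} (insert x T) \<le> links m {v} X" using T x fin X by (intro links_mono) auto
      moreover have "links m {v} X = 2" using links_B_rest[OF vP(1) P(1) c(1) P(3)] P(4) vP X by auto
      moreover have "links m {v} (insert x T) = int (m v x) + links m {v} T"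
        using links_insert_right[OF finT xT, of m "{v}"] by (simp add: links_singleton)
      ultimately have "m v x = 0" using vP by simp
      then show ?thesis using multiplicity_sym[OF m, of x v] by simp
    qed
    then show ?thesis unfolding links_singleton_left by (intro sum.neutral) auto
  qed
  have x1: "links m {x} (hits P T 1) = int ?q"
  proof -
    have "m x v = 1" if "v \<in> hits P T 1" for v using hx that multiplicity_sym[OF m, of x v] by simp
    then have "links m {x} (hits P T 1) = (\<Sum>v\<in>hits P T 1. 1)"
      unfolding links_singleton_left by (intro sum.cong) auto
    then show ?thesis by simp
  qed
  have xP: "links m {x} P = int ?q"
  proof -
    have "hits P T 2 \<inter> hits P T 1 = {}" unfolding hits_def by auto
    then have "links m {x} P = links m {x} (hits P T 2) + links m {x} (hits P T 1)"
      using links_Un_right[OF fh[of 2] fh[of 1], of m "{x}"] unfolding Psplit[symmetric] by blast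
    then show ?thesis using x1 x2 by simp
  qed
  define U where "U = insert c (T \<union> P)"
  have "U = insert c T \<union> (hits P T 2 \<union> hits P T 1)"
    unfolding U_def Psplit[symmetric] by simp
  moreover have "finite U" "x \<notin> U" "U \<subseteq> V"
    using finT finP xT xV TV P c B_sub unfolding U_def by auto
  ultimately have U: "finite U" "x \<notin> U" "U \<subseteq> V" "U = insert c T \<union> (hits P T 2 \<union> hits P T 1)" by auto
  have xU: "links m {x} U = 1 + links m {x} T + int ?q"
  proof -
    have "links m {x} U = links m {x} {c} + links m {x} (T \<union> P)"
      unfolding U_def using finT finP TV P by (intro links_insert_right) auto
    then show ?thesis using links_Un_right[OF finT finP TV(3), of m "{x}"] xP xc by (simp add: links_singleton)
  qed
  have potU: "pot N m k U = pot N m k T + 7 - 5 * int ?p - int ?q"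
    using t(4) U(4) cT c by simp
  have potY: "pot N m k (insert x U) = pot N m k T - 9 + 2 * int (k x) - 4 * links m {x} T"
    using pot_insert[OF m U(1,2), of N k] potU xU N a(5) by simp
  have up: "pot N m k T \<le> 10 - 2 * int ?q" using bad t(1) a(5) by simp
  have kx: "k x \<le> 2" using kN[OF xV(1)] N by simp
  have e0: "0 \<le> links m {x} T" by simp
  \<comment> \<open>If this set were proper, its potential would be at most \<open>5 - 2 q\<close>,
    where \<open>q = ?q \<ge> 1\<close>, and not at least 4.\<close>
  have YV: "insert x U = V"
  proof (rule ccontr)
    assume "insert x U \<noteq> V"
    then have "insert x U \<subset> V" using U xV by auto
    moreover have "2 \<le> card (insert x U)"
    proof -
      have "card {x, c} \<le> card (insert x U)" using U(1) by (intro card_mono) (auto simp: U_def simp del: Un_insert_left)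
      then show ?thesis using xV by simp
    qed
    ultimately have "4 \<le> pot N m k (insert x U)" using pot_proper[of "insert x U"] N by simp
    then show False using potY up kx e0 q0 by linarith
  qed
  have potV: "-1 \<le> pot N m k T - 9 + 2 * int (k x) - 4 * links m {x} T"
    using pot_ge[of V] potY YV c by auto
  have dx: "links m {x} V = 1 + links m {x} T + int ?q"
    using links_insert_right[OF U(1,2), of m "{x}"] xU YV by simp
  obtain w where w: "w \<in> P" "m w x = 1" using a(2) hx unfolding hits_def by auto
  have xB: "x \<notin> B" using B_independent[of w x] w P by auto
  have kx1: "1 \<le> k x" using B_props(4)[of w x] w P xV by auto
  have d3: "3 \<le> links m {x} V" using min_degree(2)[OF xV(1) kx1] .
  \<comment> \<open>Let \<open>q = ?q\<close> and \<open>e = links m {x} T\<close>, so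
    \<open>x\<close> has degree \<open>1 + e + q\<close>. The potential of \<open>V\<close> yields
    \<open>2 e + q \<le> 3\<close> for capacity 2 and \<open>2 e + q \<le> 2\<close> for capacity 1.
    As \<open>x\<close> is not in \<open>B\<close>, capacity 2 requires degree 4 and leaves only
    \<open>q = 3\<close>, \<open>e = 0\<close>. Capacity 1 contradicts \<open>B_nbrs_of_1_3\<close>
    or the minimum degree.\<close>
  show False
  proof (cases "k x = 2")
    case True
    then have "links m {x} V \<noteq> 3" using xB xV unfolding B_def by auto
    then have e3: "3 - int ?q \<le> links m {x} T" using d3 dx by linarith
    have q3: "?q = 3" and e: "links m {x} T = 0"
      using e3 potV up True a(5) e0 by linarith+
    then have "?p = 0" using a(5) by simp
    then have "hits P T 2 = {}" using fh by simp
    then have le: "links m {v} T \<le> 1" if "v \<in> P" for v using Psplit that unfolding hits_def by auto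
    show False
      by (rule deficient_set_single_exit[OF P(1,3) TV(1,2) xT TV(3) _ xV(3)[symmetric] xV(2) x(2) c(2) True cT e le])
         (use YV U_def in auto)
  next
    case False
    then have k1: "k x = 1" using kx kx1 by simp
    have "?q < 2"
    proof (rule ccontr)
      assume "\<not> ?q < 2"
      moreover have "links m {x} P \<le> links m {x} B" using P finite_B by (intro links_mono) auto
      ultimately have "\<not> links m {x} B \<le> 1" using xP by simp
      then have "links m {x} V \<noteq> 3" using B_nbrs_of_1_3[OF xV(1) k1] by auto
      then show False using d3 dx potV up k1 a(5) e0 \<open>\<not> ?q < 2\<close> by simp
    qed
    then show False using d3 dx potV up k1 q0 by simp
  qed
qed

text \<open>
  Otherwise take a deficient set \<open>T\<close> of least lowered potential, and \<open>v \<in> hits P T 1\<close> with neighbours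
  \<open>a \<in> T\<close> and \<open>b \<in> X - T\<close>, \<open>b \<noteq> x\<close>. Colour \<open>T\<close> first, without lowering \<open>a\<close> on behalf of \<open>v\<close>, then
  extend to \<open>X\<close>. If \<open>a\<close> is in \<open>F\<close>, no slack at \<open>a\<close> was needed. If \<open>a\<close> is in \<open>M\<close>, then \<open>v\<close> goes to \<open>F\<close>
  and an auxiliary edge \<open>b x\<close>, later subdivided by \<open>v\<close> and \<open>c\<close>, prevents a cycle through them.
\<close>

lemma B_nbrs_of_2_4:
  assumes c: "c \<in> V" "k c = 2" "links m {c} V = 4"
  shows "links m {c} B \<le> 2"
proof (rule ccontr)
  assume "\<not> ?thesis"
  then obtain P where P: "P \<subseteq> B" "card P = 3" "\<And>v. v \<in> P \<Longrightarrow> m v c = 1" "c \<notin> P" "links m {c} P = 3"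
    using obtain_B_nbrs[OF c(1), of 3] by auto
  have Pc: "\<forall>v\<in>P. m v c = 1" using P(3) by blast
  obtain v0 where "v0 \<in> P" using P(2) by fastforce
  then have N: "N = 2" using B_props(1) P by auto
  have finP: "finite P" using finite_B P by auto
  define X where "X = V - P - {c}"
  have finX: "finite X" using fin unfolding X_def by auto
  have VX: "V = insert c (X \<union> P)" "c \<notin> X \<union> P" "X \<inter> P = {}" using c P B_sub unfolding X_def by auto
  have "links m {c} V = links m {c} {c} + links m {c} (X \<union> P)"
    by (subst (1) VX(1), rule links_insert_right) (use VX finX finP in auto)
  then have cX: "links m {c} X = 1"
    using links_Un_right[OF finX finP VX(3), of m "{c}"] c P by simp
  obtain x where x: "x \<in> X" "m c x = 1" "\<forall>u\<in>X. u \<noteq> x \<longrightarrow> m c u = 0"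
    using links_one_unique[OF cX finX] by metis
  define pot0 where "pot0 = (\<lambda>T. pot N m k T - 2 * links m P T)"
  have "finite (Pow X)" "Pow X \<noteq> {}" using finX by auto
  then obtain T where "T \<in> Pow X" and Tmin': "\<And>U. U \<in> Pow X \<Longrightarrow> pot0 T \<le> pot0 U"
    using finite_minimizer[of "Pow X" pot0] by metis
  then have T: "T \<subseteq> X" and Tmin: "\<And>U. U \<subseteq> X \<Longrightarrow> pot0 T \<le> pot0 U" by auto
  note aux = deficient_set_hits[OF P(1,2,4) Pc c(1,2) X_def x]
  have badT: "pot0 T \<le> -2"
  proof (rule ccontr)
    assume "\<not> ?thesis"
    then have "-1 \<le> pot0 U" if "U \<subseteq> X" for U using Tmin[OF that] by linarith
    then show False
      using attach_lowered[OF P(1) c(1) P(4,3) X_def] cX unfolding pot0_def by simp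
  qed
  note auxT = aux[OF T badT[unfolded pot0_def]]
  have "\<not> (x \<notin> T \<and> (\<forall>v\<in>hits P T 1. m v x = 1))"
    using not_all_exits_equal[OF P(1,2,4) Pc c(1,2) X_def x T badT[unfolded pot0_def]] by blast
  then obtain v where v: "v \<in> hits P T 1" "x \<in> T \<or> m v x \<noteq> 1" using auxT(2) by blast
  have vP: "v \<in> P" "links m {v} T = 1" using v unfolding hits_def by auto
  have finT: "finite T" "finite (X - T)" using T finX finite_subset by auto
  have vX: "links m {v} X = 2" using links_B_rest[OF vP(1) P(1) c(1) P(4)] P(3) vP X_def by auto
  moreover have "links m {v} (T \<union> (X - T)) = links m {v} T + links m {v} (X - T)"
    using finT by (intro links_Un_right) auto
  moreover have "T \<union> (X - T) = X" using T by auto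
  ultimately have vXT: "links m {v} (X - T) = 1" using vP by simp
  obtain a where a: "a \<in> T" "m v a = 1" "\<And>u. u \<in> T \<Longrightarrow> u \<noteq> a \<Longrightarrow> m v u = 0"
    using links_one_unique[OF vP(2) finT(1)] by metis
  obtain b where b: "b \<in> X - T" "m v b = 1" "\<And>u. u \<in> X - T \<Longrightarrow> u \<noteq> b \<Longrightarrow> m v u = 0"
    using links_one_unique[OF vXT finT(2)] by metis
  have bx: "b \<noteq> x" using v(2) b by auto
  define P' where "P' = P - {v}"
  have P': "P' \<subseteq> B" "finite P'" "P = insert v P'" "v \<notin> P'" "c \<notin> P'"
    using P finP vP unfolding P'_def by auto
  have linksP: "links m P U = links m {v} U + links m P' U" for U
    using links_insert_left[OF P'(2,4), of m U] P'(3) by simp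
  have linksP2: "links m {u} P = int (m u v) + links m {u} P'" for u
    using links_insert_right[OF P'(2,4), of m "{u}"] P'(3) by (simp add: links_singleton)
  define kT where "kT = (\<lambda>u. k u - nat (links m {u} P'))"
  have kT_le: "kT u \<le> k u" for u unfolding kT_def by simp
  have TV: "T \<subset> V" "X \<subseteq> V" "X \<subset> V" using T c unfolding X_def by auto
  have "-1 \<le> pot N m kT U" if U: "U \<subseteq> T" "U \<noteq> {}" for U
  proof -
    have "pot N m k U - 2 * links m P' U \<le> pot N m kT U"
      using pot_lower[of N m k U "\<lambda>u. nat (links m {u} P')"] links_P_right[OF P'(1), of U]
      unfolding kT_def by simp
    then have low: "pot0 U + 2 * links m {v} U \<le> pot N m kT U" using linksP[of U] unfolding pot0_def by simp
    show ?thesis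
    proof (cases "pot0 U \<le> -2")
      case False
      then show ?thesis using low links_nonneg[of m "{v}" U] by linarith
    next
      case True
      have UX: "U \<subseteq> X" using U T by auto
      note auxU = aux[OF UX True[unfolded pot0_def]]
      \<comment> \<open>A deficient set sees every vertex of \<open>P\<close>, so dropping the
        demand of \<open>v\<close> returns at least 2, which lifts -3 to -1.\<close>
      have "links m {v} U \<noteq> 0" using auxU(1) vP unfolding hits_def by auto
      then have "1 \<le> links m {v} U" using links_nonneg[of m "{v}" U] by linarith
      then show ?thesis using low auxU(4) unfolding pot0_def by simp
    qed
  qed
  then obtain M0 where M0: "col m kT T M0" using sparse_proper[OF TV(1) kT_le] by blast
  have M0T: "M0 \<subseteq> T" using M0 unfolding col_def by simp
  have Tne: "T \<noteq> {}" using a by auto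
  have cardX: "card (X - T) + 1 < card V"
  proof -
    have "card (X - T) \<le> card X" using finX by (intro card_mono) auto
    moreover have "card V = card (X \<union> P) + 1" using VX finX finP by (metis card_insert_disjoint Suc_eq_plus1 finite_UnI)
    moreover have "card (X \<union> P) = card X + 3" using card_Un_disjoint[OF finX finP VX(3)] P by simp
    ultimately show ?thesis by linarith
  qed
  have IH': "\<And>(m' :: 'v \<Rightarrow> 'v \<Rightarrow> nat) k' V'. multiplicity_fun m' \<Longrightarrow> sparse N m' k' V' \<Longrightarrow>
      card V' \<le> card (X - T) + 1 \<Longrightarrow> \<exists>M. col m' k' V' M" using IH cardX by (meson le_less_trans)
  \<comment> \<open>\<open>R\<close> collects the vertices of \<open>P\<close> for which nothing is
    reserved on \<open>W\<close>. As \<open>pot0 T\<close> is least, adding \<open>W\<close> to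
    \<open>T\<close> loses nothing, and each edge from \<open>R\<close> to \<open>W\<close> gains
    2.\<close>
  have grow: "pot N m k1 T + pot0 (T \<union> W) - pot0 T + 2 * links m R W \<le> pot N m k1 (T \<union> W)"
    if W: "W \<subseteq> X - T" and R: "R \<subseteq> P" and k1: "\<And>u. u \<in> W \<Longrightarrow> k1 u = k u - nat (links m {u} (P - R))" for W R k1
  proof -
    have fW: "finite W" "T \<inter> W = {}" using W finT finite_subset by auto
    have fR: "finite R" "finite (P - R)" "P - R \<subseteq> B" using finP R finite_subset P by auto
    have "links m P W = links m (R \<union> (P - R)) W" using R by (simp add: Un_absorb1)
    also have "\<dots> = links m R W + links m (P - R) W" using fR by (intro links_Un_left) auto
    finally have lP: "links m P W = links m R W + links m (P - R) W" .
    have "pot N m k1 W = pot N m (\<lambda>u. k u - nat (links m {u} (P - R))) W"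
      using k1 by (intro pot_cong_caps) auto
    then have "pot N m k W - 2 * links m (P - R) W \<le> pot N m k1 W"
      using pot_lower[of N m k W "\<lambda>u. nat (links m {u} (P - R))"] links_P_right[OF fR(3), of W] by simp
    then show ?thesis
      using pot_Un[OF m finT(1) fW, of N k1] pot_Un[OF m finT(1) fW, of N k] lP
        links_Un_right[OF finT(1) fW, of m P] unfolding pot0_def by simp
  qed
  have N1: "1 \<le> N" using N by simp
  show False
  proof (cases "a \<in> M0")
    case False
    \<comment> \<open>On \<open>T\<close> this agrees with \<open>kT\<close>, because
      \<open>a\<close> is the only neighbour of \<open>v\<close> there; the demand of
      \<open>v\<close> is dropped at \<open>a\<close> alone.\<close>
    define kA where "kA = (\<lambda>u. if u = a then kT u else k u - nat (links m {u} P))"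
    have "kT u \<le> kA u" if "u \<in> M0" for u
    proof (cases "u = a")
      case True then show ?thesis unfolding kA_def by simp
    next
      case False
      have "m v u = 0" using a(3)[of u] False that M0T by auto
      then have "m u v = 0" using multiplicity_sym[OF m, of u v] by simp
      then show ?thesis unfolding kA_def kT_def linksP2 by simp
    qed
    then have colA: "col m kA T M0" using col_mono_caps[OF M0] by blast
    obtain M where M: "col m kA X M" "M \<inter> T = M0"
    proof (rule extend_coloring[OF m N1 finX _ T Tne colA IH'])
      show "int (kA u) \<le> N" if "u \<in> X" for u
        using kN[of u] kT_le[of u] that TV unfolding kA_def by (auto simp: subset_eq le_diff_conv of_nat_diff)
      show "pot N m kA T - (if 0 < links m W (T - M0) then 2 * N else 1) \<le> pot N m kA (T \<union> W)"
        if W: "W \<subseteq> X - T" "W \<noteq> {}" for W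
      proof -
        have "pot N m kA T + pot0 (T \<union> W) - pot0 T + 2 * links m {} W \<le> pot N m kA (T \<union> W)"
          using W a by (intro grow) (auto simp: kA_def)
        moreover have "pot0 T \<le> pot0 (T \<union> W)" using T W by (intro Tmin) auto
        ultimately show ?thesis using N by auto
      qed
    qed
    have MX: "M \<subseteq> X" using M unfolding col_def by simp
    have aM: "a \<notin> M" using M(2) a False by auto
    show False
    proof (rule attach[OF P(1) c(1) P(4,3) X_def MX])
      show "acyc m M" using M unfolding col_def by simp
      have "links m {c} (X - M) \<le> links m {c} X" using finX by (intro links_mono) auto
      then show "acyc m (insert c (X - M))"
        using M cX finX VX unfolding col_def by (intro acyc_insert[OF m]) auto
      show "links m {u} M + links m {u} P < int (k u)" if "u \<in> M" for u
      proof -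
        have "links m {u} M < int (kA u)" using M that unfolding col_def by auto
        moreover have "kA u = k u - nat (links m {u} P)" using that aM unfolding kA_def by auto
        ultimately show ?thesis using links_nonneg[of m "{u}" M] links_nonneg[of m "{u}" P] by linarith
      qed
    qed
  next
    case True
    define m' where "m' = add_edge m b x"
    have m': "multiplicity_fun m'" unfolding m'_def using multiplicity_add_edge[OF m bx] .
    have eqT: "m' u w = m u w" if "u \<in> T" "w \<in> T" for u w
      unfolding m'_def using that b by (intro add_edge_other) auto
    have colT: "col m' kT T M0"
    proof -
      have "acyc m' M0" "acyc m' (T - M0)"
        using M0 M0T acyc_cong[of M0 m' m] acyc_cong[of "T - M0" m' m] eqT unfolding col_def by blast+
      moreover have "links m' {u} M0 = links m {u} M0" if "u \<in> M0" for u
        using that eqT M0T by (intro links_cong) auto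
      ultimately show ?thesis using M0 unfolding col_def by auto
    qed
    obtain M where M: "col m' kT X M" "M \<inter> T = M0"
    proof (rule extend_coloring[OF m' N1 finX _ T Tne colT IH'])
      show "int (kT u) \<le> N" if "u \<in> X" for u using kN[of u] kT_le[of u] that TV by fastforce
      show "pot N m' kT T - (if 0 < links m' W (T - M0) then 2 * N else 1) \<le> pot N m' kT (T \<union> W)"
        if W: "W \<subseteq> X - T" "W \<noteq> {}" for W
      proof -
        have fW: "finite W" "finite (T \<union> W)" using W finT finite_subset by auto
        have g: "pot N m kT T + pot0 (T \<union> W) - pot0 T + 2 * links m {v} W \<le> pot N m kT (T \<union> W)"
          using W vP by (intro grow) (auto simp: kT_def P'_def)
        have g0: "pot0 T \<le> pot0 (T \<union> W)" using T W by (intro Tmin) auto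
        have e1: "pot N m' kT T = pot N m kT T"
          unfolding m'_def pot_add_edge[OF finT(1) bx] using b by simp
        have e2: "pot N m' kT (T \<union> W) = pot N m kT (T \<union> W) - 4 * of_bool (b \<in> W \<and> x \<in> T \<union> W)"
          unfolding m'_def pot_add_edge[OF fW(2) bx] using b N by auto
        have "pot N m' kT T - 1 \<le> pot N m' kT (T \<union> W)"
        proof (cases "b \<in> W \<and> x \<in> T \<union> W")
          case False
          then have "of_bool (b \<in> W \<and> x \<in> T \<union> W) = (0::int)" by (simp only: of_bool_eq)
          then show ?thesis using g g0 e1 e2 links_nonneg[of m "{v}" W] by linarith
        next
          case True
          have "links m {v} {b} \<le> links m {v} W" using True fW by (intro links_mono) auto
          then have vW: "1 \<le> links m {v} W" using b by (simp add: links_singleton)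
          have TW: "T \<union> W \<subseteq> X" using T W by auto
          \<comment> \<open>The auxiliary edge costs 4 and the edge \<open>v b\<close> returns 2.
            Another 1 is gained because \<open>T \<union> W\<close> is not deficient: it contains
            \<open>x\<close> and two neighbours of \<open>v\<close>, whereas a deficient set
            containing \<open>x\<close> has no double hits. The remaining loss 1 is allowed.\<close>
          have "\<not> pot0 (T \<union> W) \<le> -2"
          proof
            assume "pot0 (T \<union> W) \<le> -2"
            then have "hits P (T \<union> W) 2 = {}" using aux(3)[OF TW] True unfolding pot0_def by blast
            moreover have "links m {v} (T \<union> W) = links m {v} T + links m {v} W"
              using finT fW W by (intro links_Un_right) auto
            moreover have "links m {v} (T \<union> W) \<le> links m {v} X" using TW finX by (intro links_mono) auto
            ultimately show False using vX vP vW unfolding hits_def by auto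
          qed
          then show ?thesis using True g e1 e2 vW badT by simp
        qed
        then show ?thesis using N by auto
      qed
    qed
    have MX: "M \<subseteq> X" using M unfolding col_def by simp
    have aM: "a \<in> M" using M(2) True by auto
    have vX': "v \<in> V" "v \<notin> X" "v \<noteq> c" "v \<noteq> x" using vP P B_sub x unfolding X_def by auto
    have le': "links m Y Z \<le> links m' Y Z" for Y Z unfolding m'_def by (rule links_le_add_edge)
    define F where "F = X - M"
    have finF: "finite F" "v \<notin> F" "c \<notin> insert v F" using finX vX' VX unfolding F_def by auto
    have vu: "m v u \<le> of_bool (u = b)" if "u \<in> F" for u
    proof -
      have "u \<noteq> a" "u \<in> X" using that aM unfolding F_def by auto
      then show ?thesis using a(3)[of u] b(2,3) by (cases "u \<in> T"; cases "u = b") auto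
    qed
    have "acyc m' F" using M unfolding col_def F_def by simp
    moreover have "m' u w = add_edge (add_edge m v x) b x u w" if "u \<in> F" "w \<in> F" for u w
    proof -
      have "add_edge m v x u w = m u w" using that finF by (intro add_edge_other) auto
      then show ?thesis unfolding m'_def add_edge_def[of _ b x] by simp
    qed
    ultimately have "acyc (add_edge (add_edge m v x) b x) F"
      using acyc_cong[of F m' "add_edge (add_edge m v x) b x"] by blast
    \<comment> \<open>First \<open>v\<close> subdivides \<open>b x\<close>; its edge to
      \<open>x\<close> is again auxiliary and is then subdivided by \<open>c\<close>, whose edges to
      \<open>v\<close> and \<open>x\<close> are real.\<close>
    then have aF: "acyc (add_edge m v x) (insert v F)"
    proof (rule acyc_insert_subdivide[OF multiplicity_add_edge[OF m vX'(4)] finF(1,2) bx])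
      show "add_edge m v x v u \<le> of_bool (u = b) + of_bool (u = x)" if "u \<in> F" for u
      proof -
        have "u \<noteq> v" using that finF by auto
        then have "add_edge m v x v u = m v u + of_bool (u = x)"
          unfolding add_edge_def doubleton_eq_iff by (simp add: of_bool_def)
        then show ?thesis using vu[OF that] by simp
      qed
    qed
    have aF2: "acyc m (insert c (insert v F))"
    proof (rule acyc_insert_subdivide[OF m _ finF(3) vX'(4) aF])
      show "m c u \<le> of_bool (u = v) + of_bool (u = x)" if "u \<in> insert v F" for u
      proof (cases "u = v")
        case True
        have "m v c = 1" using P(3) vP by simp
        then have "m c v = 1" using multiplicity_sym[OF m, of c v] by simp
        then show ?thesis using True by simp
      next
        case False
        then show ?thesis using that x unfolding F_def by (cases "u = x") auto
      qed
    qed (use finF in auto)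
    show False
    \<comment> \<open>Here \<open>v\<close> is already placed in \<open>F\<close>, so it counts as
      part of the coloured set and only \<open>P'\<close> is attached.\<close>
    proof (rule attach[OF P'(1) c(1) P'(5), of "insert v X" M])
      show "m w c = 1" if "w \<in> P'" for w using P(3) that P'(3) by auto
      show "insert v X = V - P' - {c}" using P'(3,4) vX' VX unfolding X_def by auto
      show "M \<subseteq> insert v X" using MX by auto
      show "acyc m M" using M le' acyc_links_le[of m' M m] unfolding col_def by auto
      have "insert v X - M = insert v F" using MX vX' unfolding F_def by auto
      then show "acyc m (insert c (insert v X - M))" using aF2 by simp
      show "links m {u} M + links m {u} P' < int (k u)" if "u \<in> M" for u
      proof -
        have "links m' {u} M < int (kT u)" using M that unfolding col_def by auto
        then have "links m {u} M < int (k u - nat (links m {u} P'))"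
          using le'[of "{u}" M] unfolding kT_def by linarith
        then show ?thesis using links_nonneg[of m "{u}" M] links_nonneg[of m "{u}" P'] by linarith
      qed
    qed
  qed
qed

end

section \<open>Discharging\<close>

lemma pot_sum_charges:
  "pot N m k V = (\<Sum>v\<in>V. 2 * N - 1 + 2 * int (k v) - N * links m {v} V)"
  unfolding pot_def links_sum_left[of m V V] by (simp add: sum_subtractf sum_distrib_left)

context min_counterexample
begin

text \<open>Outside \<open>B\<close>, capacity 0 comes with degree at least 2, capacity 1 with at
  least 3, and larger capacity with at least 4. Each charge is then at most -1, and two vertices
  already push the sum below -1.\<close>

lemma B_nonempty: "B \<noteq> {}"
proof
  assume B: "B = {}"
  have "2 * N - 1 + 2 * int (k v) - N * links m {v} V \<le> -1" if v: "v \<in> V" for v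
  proof -
    have mult: "N * d \<le> N * links m {v} V" if "d \<le> links m {v} V" for d
      using that N2 by (intro mult_left_mono) auto
    consider "k v = 0" | "k v = 1" "3 \<le> links m {v} V" | "4 \<le> links m {v} V"
    proof -
      have "k v = 0 \<or> k v = 1 \<and> 3 \<le> links m {v} V \<or> 4 \<le> links m {v} V"
      proof (cases "2 \<le> k v")
        case True
        then have "links m {v} V \<noteq> 3" using B v unfolding B_def by auto
        then show ?thesis using min_degree(2)[OF v] True by linarith
      next
        case False
        then have "k v = 0 \<or> k v = 1" by linarith
        then show ?thesis using min_degree(2)[OF v] by auto
      qed
      then show ?thesis using that by blast
    qed
    then show ?thesis
    proof cases
      case 1
      then show ?thesis using mult[OF min_degree(1)[OF v]] by simp
    next
      case 2
      then show ?thesis using mult[OF 2(2)] N2 by (simp only: of_nat_1)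
    next
      case 3
      then show ?thesis using mult[OF 3] kN[OF v] by simp
    qed
  qed
  then have "pot N m k V \<le> (\<Sum>v\<in>V. -1)" unfolding pot_sum_charges by (rule sum_mono)
  then have "pot N m k V \<le> - int (card V)" by simp
  moreover have "-1 \<le> pot N m k V" using card_V by (intro pot_ge) auto
  ultimately show False using card_V by linarith
qed

text \<open>After discharging, every vertex of \<open>A\<close> keeps at most -1/3, so potential at
  least -1 means at most three of them. The neighbours of a vertex of \<open>B\<close> are three,
  hence they are all of \<open>A\<close> and every estimate is sharp, which makes \<open>A\<close> a
  triangle completely joined to \<open>B\<close>. An edge of the triangle serves as
  \<open>M\<close>; the third vertex and \<open>B\<close> form a star in \<open>F\<close>.\<close>

lemma no_min_counterexample: False
proof -
  obtain v0 where v0: "v0 \<in> B" using B_nonempty by auto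
  have N: "N = 2" using B_props(1)[OF v0] .
  define A where "A = V - B"
  have finA: "finite A" "finite B" using fin finite_B unfolding A_def by auto
  have VAB: "V = A \<union> B" "A \<inter> B = {}" using B_sub unfolding A_def by auto
  \<comment> \<open>Three times the charge, after every vertex of \<open>B\<close> sent 1/3 to each neighbour.\<close>
  define ch where "ch = (\<lambda>a. 3 * (3 + 2 * int (k a) - 2 * links m {a} V) + links m {a} B)"
  have dB: "links m {v} A = 3" if v: "v \<in> B" for v
  proof -
    have "links m {v} V = links m {v} A + links m {v} B"
      using links_Un_right[OF finA VAB(2), of m "{v}"] VAB(1) by simp
    moreover have "links m {v} B = 0" using links_B_B[of "{v}" B] v by simp
    ultimately show ?thesis using v unfolding B_def by simp
  qed
  have pot3: "3 * pot N m k V = (\<Sum>a\<in>A. ch a)"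
  proof -
    have "pot N m k V = (\<Sum>v\<in>A. 3 + 2 * int (k v) - 2 * links m {v} V)
        + (\<Sum>v\<in>B. 3 + 2 * int (k v) - 2 * links m {v} V)"
      unfolding pot_sum_charges N using sum.union_disjoint[OF finA VAB(2)] VAB(1) by simp
    moreover have "(\<Sum>v\<in>B. 3 + 2 * int (k v) - 2 * links m {v} V) = (\<Sum>v\<in>B. 1)"
      using B_props(2) by (intro sum.cong) (auto simp: B_def)
    moreover have "(\<Sum>a\<in>A. links m {a} B) = (\<Sum>v\<in>B. 3)"
    proof -
      have "(\<Sum>a\<in>A. links m {a} B) = links m B A"
        using links_sum_left[of m A B] links_sym[OF m, of A B] by simp
      also have "\<dots> = (\<Sum>v\<in>B. 3)" unfolding links_sum_left[of m B A] using dB by (intro sum.cong) auto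
      finally show ?thesis .
    qed
    moreover have "(\<Sum>a\<in>A. ch a) = 3 * (\<Sum>v\<in>A. 3 + 2 * int (k v) - 2 * links m {v} V) + (\<Sum>a\<in>A. links m {a} B)"
      unfolding ch_def by (simp only: sum.distrib sum_distrib_left)
    ultimately show ?thesis by simp
  qed
  have bd: "links m {a} B \<le> links m {a} V" for a
    using VAB fin by (intro links_mono) auto
  have ch: "ch a \<le> -1 \<and> (ch a = -1 \<longrightarrow> k a = 2 \<and> links m {a} V = 4 \<and> links m {a} B = 2)" if a: "a \<in> A" for a
  proof -
    have aV: "a \<in> V" "a \<notin> B" using a unfolding A_def by auto
    have ka: "k a \<le> 2" using kN[OF aV(1)] N by simp
    note d = min_degree[OF aV(1)]
    consider "k a = 0" | "k a = 1" "links m {a} V = 3" | "k a = 1" "4 \<le> links m {a} V"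
      | "k a = 2" "links m {a} V = 4" | "k a = 2" "5 \<le> links m {a} V"
    proof -
      have "k a = 0 \<or> k a = 1 \<or> k a = 2" using ka by linarith
      moreover have "k a = 2 \<Longrightarrow> links m {a} V \<noteq> 3" using aV unfolding B_def by auto
      ultimately have "k a = 0 \<or> k a = 1 \<and> links m {a} V = 3 \<or> k a = 1 \<and> 4 \<le> links m {a} V \<or>
        k a = 2 \<and> links m {a} V = 4 \<or> k a = 2 \<and> 5 \<le> links m {a} V"
        using d(2) by (elim disjE) auto
      then show ?thesis using that by blast
    qed
    then show ?thesis
    proof cases
      case 1
      have "m a v = 0" if "v \<in> B" for v
        using B_props(4)[OF that aV(1)] 1 multiplicity_sym[OF m, of a v] by (cases "m v a = 0") auto
      then have "links m {a} B = 0" unfolding links_singleton_left by (intro sum.neutral) auto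
      then show ?thesis unfolding ch_def using 1 d(1) by simp
    next
      case 2
      then show ?thesis unfolding ch_def using B_nbrs_of_1_3[OF aV(1) 2] by simp
    next
      case 3
      then show ?thesis unfolding ch_def using bd[of a] by simp
    next
      case 4
      then show ?thesis unfolding ch_def using B_nbrs_of_2_4[OF aV(1) 4] by auto
    next
      case 5
      then show ?thesis unfolding ch_def using bd[of a] by simp
    qed
  qed
  have potV: "-1 \<le> pot N m k V" using card_V by (intro pot_ge) auto
  have nb: "{u \<in> V. 0 < m v u} \<subseteq> A" if "v \<in> B" for v
    using B_independent[OF that] unfolding A_def by auto
  have "(\<Sum>a\<in>A. ch a) \<le> (\<Sum>a\<in>A. -1)" using ch by (intro sum_mono) auto
  then have "card A \<le> 3" using pot3 potV by simp
  then have nbA: "{u \<in> V. 0 < m v u} = A" if "v \<in> B" for v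
    using card_seteq[OF finA(1) nb[OF that]] B_props(5)[OF that] by simp
  then have cA: "card A = 3" using B_props(5)[OF v0] v0 by metis
  have ch1: "ch a = -1" if "a \<in> A" for a
  proof (rule ccontr)
    assume "ch a \<noteq> -1"
    then have "ch a < -1" using ch[OF that] by linarith
    then have "(\<Sum>a\<in>A. ch a) < (\<Sum>a\<in>A. -1)" using ch that finA by (intro sum_strict_mono_ex1) auto
    then show False using pot3 potV cA by simp
  qed
  have A_props: "k a = 2" "links m {a} V = 4" "links m {a} B = 2" if "a \<in> A" for a
    using ch[OF that] ch1[OF that] by auto
  have mBA: "m v a = 1" if "v \<in> B" "a \<in> A" for v a
    using nbA[OF that(1)] B_props(3)[OF that(1), of a] that(2) by force
  have lA: "links m {a} A = 2" if "a \<in> A" for a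
    using links_Un_right[OF finA VAB(2), of m "{a}"] A_props[OF that] VAB(1) by simp
  obtain a b c where abc: "A = {a, b, c}" "a \<noteq> b" "a \<noteq> c" "b \<noteq> c"
    using cA by (auto simp: card_3_iff)
  have "links m {u} A = int (m u a) + int (m u b) + int (m u c)" for u
    unfolding links_singleton_left abc(1) using abc by simp
  then have "int (m a b) + int (m a c) = 2" "int (m b a) + int (m b c) = 2" "int (m c a) + int (m c b) = 2"
    using lA[of a] lA[of b] lA[of c] abc by auto
  moreover have "m b a = m a b" "m c a = m a c" "m c b = m b c" using multiplicity_sym[OF m] by metis+
  ultimately have ab: "m a b = 1" "m b a = 1" by linarith+
  have "col m k V {a, b}"
    unfolding col_def
  proof (intro conjI)
    show "{a, b} \<subseteq> V" using abc VAB by auto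
    show "acyc m {a, b}"
      using acyc_insert[OF m, of "{b}" a] acyc_singleton[OF m, of b] abc ab by (simp add: links_singleton)
    have "acyc m ({c} \<union> B)"
    proof (rule acyc_attach[OF m])
      show "acyc m {c}" using acyc_singleton[OF m] .
      show "{c} \<inter> B = {}" using abc VAB by auto
      show "m u v = 0" if "u \<in> B" "v \<in> B" for u v using B_independent that by auto
      show "links m {v} {c} \<le> 1" if "v \<in> B" for v using mBA[OF that, of c] abc by (simp add: links_singleton)
    qed (use finA in auto)
    moreover have "V - {a, b} = {c} \<union> B" using abc VAB by auto
    ultimately show "acyc m (V - {a, b})" by simp
    show "\<forall>v\<in>{a, b}. links m {v} {a, b} < int (k v)"
      using A_props(1) abc ab by (simp add: links_singleton_left)
  qed
  then show False using uncol by auto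
qed

end

text \<open>The induction on the number of vertices keeps \<open>N\<close> fixed but ranges over all
  multiplicities and capacities, since contraction changes both.\<close>

theorem sparse_colorable:
  fixes m :: "'v \<Rightarrow> 'v \<Rightarrow> nat"
  assumes "2 \<le> N" "multiplicity_fun m" "sparse N m k V"
  shows "\<exists>M. col m k V M"
  using assms(2,3)
proof (induction "card V" arbitrary: m k V rule: less_induct)
  case less
  show ?case
  proof (rule ccontr)
    assume "\<not> ?thesis"
    then interpret min_counterexample N m k V
      using less assms(1) by unfold_locales blast+
    show False by (rule no_min_counterexample)
  qed
qed

text \<open>If \<open>V\<close> had potential at least -1, some set would violate sparsity, and one
  of least potential would be proper and hence colourable. No superset has smaller potential, so its
  colouring extends: the contracted graph is sparse although the original is not.\<close>

lemma critical_pot: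
  fixes m :: "'v \<Rightarrow> 'v \<Rightarrow> nat"
  assumes N: "2 \<le> N" and m: "multiplicity_fun m" and fin: "finite V"
    and kN: "\<And>v. v \<in> V \<Longrightarrow> int (k v) \<le> N" and uncol: "\<And>M. \<not> col m k V M"
    and crit: "\<And>S. S \<subset> V \<Longrightarrow> \<exists>M. col m k S M"
  shows "pot N m k V \<le> -2"
proof (rule ccontr)
  assume V: "\<not> pot N m k V \<le> -2"
  have "finite (Pow V)" "Pow V \<noteq> {}" using fin by auto
  then obtain S where "S \<in> Pow V" and min': "\<And>T. T \<in> Pow V \<Longrightarrow> pot N m k S \<le> pot N m k T"
    using finite_minimizer[of "Pow V" "pot N m k"] by metis
  then have S: "S \<subseteq> V" and min: "\<And>T. T \<subseteq> V \<Longrightarrow> pot N m k S \<le> pot N m k T" by auto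
  have "\<not> sparse N m k V" using sparse_colorable[OF N m] uncol by blast
  then obtain T where "T \<subseteq> V" "\<not> -1 \<le> pot N m k T" using fin kN unfolding sparse_def by blast
  then have "pot N m k S < -1" using min[of T] by linarith
  then have "S \<noteq> {}" "S \<subset> V" using S V by auto
  then obtain M0 where M0: "col m k S M0" using crit by blast
  obtain M where "col m k V M"
  proof (rule extend_coloring[OF m _ fin kN S \<open>S \<noteq> {}\<close> M0])
    show "1 \<le> N" using N by simp
    show "\<exists>M. col m' k' V' M" if "multiplicity_fun m'" "sparse N m' k' V'" for m' k' and V' :: "'v set"
      using sparse_colorable[OF N that] .
    show "pot N m k S - (if 0 < links m W (S - M0) then 2 * N else 1) \<le> pot N m k (S \<union> W)"
      if "W \<subseteq> V - S" for W
    proof -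
      have "pot N m k S \<le> pot N m k (S \<union> W)" using that S by (intro min) auto
      then show ?thesis using N by auto
    qed
  qed
  then show False using uncol by auto
qed

section \<open>Back to multigraphs\<close>

abbreviation mult :: "'v mgraph \<Rightarrow> 'v \<Rightarrow> 'v \<Rightarrow> nat" where
  "mult G \<equiv> \<lambda>u v. count (medges G) {u, v}"

lemma count_add_mset_eq_add_edge:
  assumes "a \<noteq> b"
  shows "(\<lambda>u v. count (add_mset {a, b} E) {u, v}) = add_edge (\<lambda>u v. count E {u, v}) a b"
  unfolding add_edge_def by (intro ext) auto

lemma links_count_self:
  assumes "finite X" "\<forall>e\<in>#E. card e = 2"
  shows "links (\<lambda>u v. count E {u, v}) X X = 2 * int (size (filter_mset (\<lambda>e. e \<subseteq> X) E))"
  using assms(2)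
proof (induction E)
  case empty
  then show ?case by (simp add: links_def)
next
  case (add e E)
  obtain a b where e: "e = {a, b}" "a \<noteq> b" using add.prems by (auto simp: card_2_iff)
  show ?case
    unfolding e(1) count_add_mset_eq_add_edge[OF e(2)] links_add_edge[OF assms(1,1) e(2)]
    using add by (cases "a \<in> X"; cases "b \<in> X") simp_all
qed

lemma links_count_singleton:
  assumes "finite X" "v \<in> X" "\<forall>e\<in>#E. card e = 2"
  shows "links (\<lambda>u v. count E {u, v}) {v} X = int (size (filter_mset (\<lambda>e. e \<subseteq> X \<and> v \<in> e) E))"
  using assms(3)
proof (induction E)
  case empty
  then show ?case by (simp add: links_def)
next
  case (add e E)
  obtain a b where e: "e = {a, b}" "a \<noteq> b" using add.prems by (auto simp: card_2_iff)
  have fv: "finite {v}" by simp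
  show ?case
    unfolding e(1) count_add_mset_eq_add_edge[OF e(2)] links_add_edge[OF fv assms(1) e(2)]
    using add assms(2) e(2) by (cases "a \<in> X"; cases "b \<in> X"; cases "v = a"; cases "v = b") simp_all
qed

lemma multiplicity_mult: "multigraph G \<Longrightarrow> multiplicity_fun (mult G)"
  unfolding multiplicity_fun_def multigraph_def
  by (auto simp: insert_commute not_in_iff[symmetric])

section \<open>Edge counts versus absence of cycles\<close>

lemma size_cycle_edges: "size (cycle_edges vs) = length vs"
  unfolding cycle_edges_def by simp

lemma cycle_edges_sub: "e \<in># cycle_edges vs \<Longrightarrow> e \<subseteq> set vs"
  unfolding cycle_edges_def
  by (auto intro!: nth_mem mod_less_divisor)

lemma cycle_not_acyc:
  assumes G: "multigraph G" and X: "X \<subseteq> mverts G" and cyc: "cycle (induced G X) vs"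
  shows "\<not> acyc (mult G) X"
proof -
  have vs: "2 \<le> length vs" "distinct vs" "set vs \<subseteq> X" "cycle_edges vs \<subseteq># medges G"
    using cyc multiset_filter_subset[of "\<lambda>e. e \<subseteq> X" "medges G"]
    unfolding cycle_def induced_def by (auto intro: subset_mset.trans)
  have "filter_mset (\<lambda>e. e \<subseteq> set vs) (cycle_edges vs) = cycle_edges vs"
    using cycle_edges_sub[of _ vs] by (auto simp: filter_mset_eq_conv)
  then have "cycle_edges vs \<subseteq># filter_mset (\<lambda>e. e \<subseteq> set vs) (medges G)"
    using multiset_filter_mono[OF vs(4), of "\<lambda>e. e \<subseteq> set vs"] by simp
  then have "length vs \<le> size (filter_mset (\<lambda>e. e \<subseteq> set vs) (medges G))"
    using size_mset_mono size_cycle_edges by metis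
  moreover have "links (mult G) (set vs) (set vs) = 2 * int (size (filter_mset (\<lambda>e. e \<subseteq> set vs) (medges G)))"
    using G by (intro links_count_self) (auto simp: multigraph_def)
  moreover have "card (set vs) = length vs" using vs(2) by (rule distinct_card)
  ultimately have "\<not> links (mult G) (set vs) (set vs) + 2 \<le> 2 * int (card (set vs))" by simp
  moreover have "set vs \<noteq> {}" using vs(1) by auto
  ultimately show ?thesis using vs(3) unfolding acyc_def by blast
qed

text \<open>From length 3 on the edges of a closed vertex sequence are pairwise different: a
  coincidence would make two positions each other's successor. So membership of each edge is enough,
  whatever its multiplicity.\<close>

lemma cycle_edges_subset:
  assumes vs: "3 \<le> length vs" "distinct vs"
    and e: "\<And>i. i < length vs \<Longrightarrow> {vs ! i, vs ! (Suc i mod length vs)} \<in># E"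
  shows "cycle_edges vs \<subseteq># E"
proof -
  let ?n = "length vs"
  let ?f = "\<lambda>i. {vs ! i, vs ! (Suc i mod ?n)}"
  have lt: "Suc i mod ?n < ?n" for i using vs by (intro mod_less_divisor) auto
  have inj: "inj_on ?f (set [0..<?n])"
  proof (rule inj_onI)
    fix i j assume ij: "i \<in> set [0..<?n]" "j \<in> set [0..<?n]" and eq: "?f i = ?f j"
    then have i: "i < ?n" "j < ?n" by auto
    show "i = j"
    proof (rule ccontr)
      assume "i \<noteq> j"
      then have "vs ! i = vs ! (Suc j mod ?n)" "vs ! (Suc i mod ?n) = vs ! j"
        using eq vs(2) i nth_eq_iff_index_eq[OF vs(2)] unfolding doubleton_eq_iff by auto
      then have "i = Suc j mod ?n" "Suc i mod ?n = j"
        using nth_eq_iff_index_eq[OF vs(2)] i lt by auto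
      then show False using i vs(1) by (auto simp: mod_Suc split: if_splits)
    qed
  qed
  have d: "distinct (map ?f [0..<?n])" using inj by (simp add: distinct_map)
  show ?thesis
    unfolding cycle_edges_def
  proof (rule mset_subset_eqI)
    fix x
    have "count (mset (map ?f [0..<?n])) x = (if x \<in> set (map ?f [0..<?n]) then 1 else 0)"
      using d unfolding distinct_count_atmost_1 by blast
    also have "\<dots> \<le> count E x" using e by (auto simp: Suc_le_eq)
    finally show "count (mset (map ?f [0..<?n])) x \<le> count E x" .
  qed
qed

text \<open>All neighbours of the first vertex of a longest path lie on the path. Either its edge to
  the second vertex is parallel to another one, or a neighbour further along closes a cycle.\<close>

lemma cycle_of_min_degree_2:
  assumes G: "multigraph G" and Y: "Y \<subseteq> mverts G" "Y \<noteq> {}"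
    and deg: "\<And>v. v \<in> Y \<Longrightarrow> 2 \<le> links (mult G) {v} Y"
  shows "\<exists>vs. set vs \<subseteq> Y \<and> cycle G vs"
proof -
  have m: "multiplicity_fun (mult G)" using multiplicity_mult[OF G] .
  have finY: "finite Y" using G Y finite_subset unfolding multigraph_def by auto
  define path where "path = (\<lambda>vs. vs \<noteq> [] \<and> distinct vs \<and> set vs \<subseteq> Y \<and>
    (\<forall>i. Suc i < length vs \<longrightarrow> 0 < mult G (vs ! i) (vs ! Suc i)))"
  obtain y where "y \<in> Y" using Y by auto
  then have ex: "path [y]" unfolding path_def by auto
  have bound: "length vs < Suc (card Y)" if "path vs" for vs
    using that card_mono[OF finY, of "set vs"] distinct_card[of vs] unfolding path_def by auto
  obtain vs where vs: "path vs" and max: "\<And>us. path us \<Longrightarrow> length us \<le> length vs"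
    using ex_has_greatest_nat[of path "[y]" length "Suc (card Y)"] ex bound by (metis less_imp_le)
  have p: "vs \<noteq> []" "distinct vs" "set vs \<subseteq> Y" using vs unfolding path_def by auto
  have pe: "0 < mult G (vs ! i) (vs ! Suc i)" if "Suc i < length vs" for i using vs that unfolding path_def by auto
  define v0 where "v0 = vs ! 0"
  have v0Y: "v0 \<in> Y" using p unfolding v0_def by auto
  have diag: "mult G v0 v0 = 0" using m unfolding multiplicity_fun_def by blast
  have nb: "u \<in> set vs" if u: "u \<in> Y" "0 < mult G u v0" for u
  proof (rule ccontr)
    assume "u \<notin> set vs"
    then have "path (u # vs)"
      unfolding path_def using p u pe by (auto simp: nth_Cons v0_def split: nat.split)
    then show False using max[of "u # vs"] by simp
  qed
  have "\<exists>u\<in>Y. 0 < mult G v0 u"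
    using deg[OF v0Y] links_pos_iff[of "{v0}" Y "mult G"] finY by auto
  then obtain w where w: "w \<in> Y" "0 < mult G v0 w" by auto
  then have "w \<in> set vs" using nb[of w] by (simp add: insert_commute)
  moreover have "w \<noteq> v0" using w diag by (metis less_numeral_extra(3))
  ultimately have len: "2 \<le> length vs"
    unfolding v0_def by (cases vs; cases "tl vs") auto
  define v1 where "v1 = vs ! 1"
  have v1: "v1 \<in> Y" "v0 \<noteq> v1" "0 < mult G v0 v1"
    using p len pe[of 0] nth_eq_iff_index_eq[OF p(2), of 0 1] unfolding v0_def v1_def by (auto simp: subset_eq)
  show ?thesis
  proof (cases "2 \<le> mult G v0 v1")
    case True
    have "cycle_edges [v0, v1] = {#{v0, v1}, {v0, v1}#}"
      unfolding cycle_edges_def by (simp add: upt_rec insert_commute)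
    also have "\<dots> \<subseteq># medges G" using True by (intro mset_subset_eqI) auto
    finally show ?thesis using v0Y v1 Y unfolding cycle_def by (intro exI[of _ "[v0, v1]"]) auto
  next
    case False
    then have one: "mult G v0 v1 = 1" using v1 by linarith
    have "links (mult G) {v0} (insert v1 (Y - {v1})) = int (mult G v0 v1) + links (mult G) {v0} (Y - {v1})"
      using finY by (subst links_insert_right) (auto simp: links_singleton)
    moreover have "insert v1 (Y - {v1}) = Y" using v1 by auto
    ultimately have "0 < links (mult G) {v0} (Y - {v1})" using deg[OF v0Y] one by simp
    then obtain u where u: "u \<in> Y" "u \<noteq> v1" "0 < mult G v0 u"
      using links_pos_iff[of "{v0}" "Y - {v1}" "mult G"] finY by auto
    then have "u \<in> set vs" using nb[of u] by (simp add: insert_commute)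
    then obtain j where j: "j < length vs" "u = vs ! j" by (metis in_set_conv_nth)
    have "j \<noteq> 0" using u j diag unfolding v0_def by (metis less_numeral_extra(3))
    moreover have "j \<noteq> 1" using u j unfolding v1_def by auto
    ultimately have j2: "2 \<le> j" by linarith
    define ws where "ws = take (Suc j) vs"
    have ws: "length ws = Suc j" "distinct ws" "set ws \<subseteq> Y" "\<And>i. i \<le> j \<Longrightarrow> ws ! i = vs ! i"
      using j p set_take_subset[of "Suc j" vs] unfolding ws_def by auto
    have "cycle_edges ws \<subseteq># medges G"
    proof (rule cycle_edges_subset)
      show "3 \<le> length ws" "distinct ws" using ws j2 by auto
      fix i assume i: "i < length ws"
      show "{ws ! i, ws ! (Suc i mod length ws)} \<in># medges G"
      proof (cases "i = j")
        case True
        then show ?thesis using u j ws by (simp add: v0_def insert_commute)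
      next
        case False
        then have "i < j" using i ws by simp
        then show ?thesis using ws pe[of i] j by simp
      qed
    qed
    then have "cycle G ws" using ws j2 Y unfolding cycle_def by auto
    then show ?thesis using ws by blast
  qed
qed

lemma multigraph_induced: "multigraph G \<Longrightarrow> multigraph (induced G X)"
  unfolding multigraph_def induced_def by auto

text \<open>For the direction from cycle-free to edge counts, a smallest set violating the count has
  minimum degree 2: deleting a vertex with at most one edge would leave a smaller violation.\<close>

lemma forest_induced_iff:
  assumes G: "multigraph G" and X: "X \<subseteq> mverts G"
  shows "forest (induced G X) \<longleftrightarrow> acyc (mult G) X"
proof
  assume "acyc (mult G) X"
  then show "forest (induced G X)"
    using cycle_not_acyc[OF G X] multigraph_induced[OF G] unfolding forest_def by blast
next
  assume f: "forest (induced G X)"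
  have m: "multiplicity_fun (mult G)" using multiplicity_mult[OF G] .
  have finX: "finite X" using G X finite_subset unfolding multigraph_def by auto
  show "acyc (mult G) X"
  proof (rule ccontr)
    assume "\<not> acyc (mult G) X"
    then obtain Z where Z: "Z \<subseteq> X" "Z \<noteq> {}" "\<not> links (mult G) Z Z + 2 \<le> 2 * int (card Z)"
      unfolding acyc_def by blast
    let ?P = "\<lambda>Z. Z \<subseteq> X \<and> Z \<noteq> {} \<and> 2 * int (card Z) \<le> links (mult G) Z Z"
    have "links (mult G) Z Z = 2 * int (size (filter_mset (\<lambda>e. e \<subseteq> Z) (medges G)))"
      using G Z finX finite_subset by (intro links_count_self) (auto simp: multigraph_def)
    then have "?P Z" using Z by presburger
    then obtain Y where Y: "?P Y" and min: "\<And>Y'. ?P Y' \<Longrightarrow> card Y \<le> card Y'"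
      using ex_has_least_nat[of ?P Z card] by blast
    have finY: "finite Y" using Y finX finite_subset by auto
    have deg: "2 \<le> links (mult G) {v} Y" if v: "v \<in> Y" for v
    proof (rule ccontr)
      assume n: "\<not> ?thesis"
      define Y' where "Y' = Y - {v}"
      have Y': "Y = insert v Y'" "v \<notin> Y'" "finite Y'" using v finY unfolding Y'_def by auto
      have vv: "links (mult G) {v} {v} = 0" using m by (simp add: links_singleton multiplicity_fun_def)
      have "links (mult G) Y Y = links (mult G) Y' Y' + 2 * links (mult G) {v} Y'"
        using links_insert_self[OF m Y'(3,2)] Y'(1) by simp
      moreover have "links (mult G) {v} Y = links (mult G) {v} Y'"
        using links_insert_right[OF Y'(3,2), of "mult G" "{v}"] vv Y'(1) by simp
      moreover have "card Y = card Y' + 1" using Y' by simp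
      ultimately have le: "2 * int (card Y') \<le> links (mult G) Y' Y'" using Y n by simp
      moreover have "Y' \<noteq> {}" using Y vv Y'(1) by auto
      ultimately have "?P Y'" using Y Y' by auto
      then show False using min[of Y'] \<open>card Y = card Y' + 1\<close> by simp
    qed
    have sub: "mult (induced G X) u v = mult G u v" if "u \<in> Y" "v \<in> Y" for u v
      using that Y unfolding induced_def by auto
    have "2 \<le> links (mult (induced G X)) {v} Y" if "v \<in> Y" for v
      using deg[OF that] links_cong[of "{v}" Y "mult (induced G X)" "mult G"] sub that by simp
    moreover have "Y \<subseteq> mverts (induced G X)" "Y \<noteq> {}" using Y X unfolding induced_def by auto
    ultimately obtain vs where "cycle (induced G X) vs"
      using cycle_of_min_degree_2[OF multigraph_induced[OF G]] by metis
    then show False using f unfolding forest_def by blast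
  qed
qed

lemma DF_colorable_induced_iff:
  assumes G: "multigraph G" and S: "S \<subseteq> mverts G"
  shows "DF_colorable D (induced G S) \<longleftrightarrow> (\<exists>M. col (mult G) (\<lambda>_. Suc D) S M)"
proof -
  have vS: "mverts (induced G S) = S" using S unfolding induced_def by auto
  have ii: "induced (induced G S) X = induced G X" if "X \<subseteq> S" for X
  proof -
    have "filter_mset (\<lambda>e. e \<subseteq> X) (filter_mset (\<lambda>e. e \<subseteq> S) (medges G)) = filter_mset (\<lambda>e. e \<subseteq> X) (medges G)"
      unfolding filter_filter_mset using that by (intro filter_mset_cong refl) auto
    then show ?thesis using that S unfolding induced_def by auto
  qed
  have deg: "links (mult G) {v} M < int (Suc D) \<longleftrightarrow> degree (induced G M) v \<le> D"
    if "M \<subseteq> S" "v \<in> M" for M v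
  proof -
    have "finite M" using that S G finite_subset unfolding multigraph_def by (meson order_trans)
    then have "links (mult G) {v} M = int (size (filter_mset (\<lambda>e. e \<subseteq> M \<and> v \<in> e) (medges G)))"
      using G that by (intro links_count_singleton) (auto simp: multigraph_def)
    then show ?thesis unfolding degree_def induced_def by (auto simp: filter_filter_mset conj_commute)
  qed
  have eq: "DF_coloring D (induced G S) M F \<longleftrightarrow> col (mult G) (\<lambda>_. Suc D) S M \<and> F = S - M" for M F
  proof -
    have "DF_coloring D (induced G S) M F \<longleftrightarrow> M \<subseteq> S \<and> F = S - M \<and>
      forest (induced G M) \<and> (\<forall>v \<in> M. degree (induced G M) v \<le> D) \<and> forest (induced G (S - M))"
    proof (cases "M \<subseteq> S \<and> F = S - M")
      case True
      then show ?thesis unfolding DF_coloring_def vS using ii[of M] ii[of F] by auto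
    next
      case False
      then show ?thesis unfolding DF_coloring_def vS by auto
    qed
    moreover have "M \<subseteq> S \<Longrightarrow> M \<subseteq> mverts G" "S - M \<subseteq> mverts G" using S by auto
    ultimately show ?thesis unfolding col_def using forest_induced_iff[OF G] deg by blast
  qed
  then show ?thesis unfolding DF_colorable_def by auto
qed

theorem theorem1p4:
  fixes D :: nat and G :: "'v mgraph"
  assumes "D \<ge> 1"
    and "DF_critical D G"
    and "card (mverts G) \<ge> 3"
  shows "real (size (medges G)) \<ge>
    ((4 * real D + 3) * real (card (mverts G)) + 2) / (2 * (real D + 1))"
proof -
  let ?V = "mverts G" and ?N = "int D + 1"
  have G: "multigraph G" and nc: "\<not> DF_colorable D G"
    and crit: "\<And>H. proper_subgraph H G \<Longrightarrow> DF_colorable D H"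
    using assms(2) unfolding DF_critical_def by auto
  have fin: "finite ?V" and edges: "\<forall>e\<in>#medges G. e \<subseteq> ?V" "\<forall>e\<in>#medges G. card e = 2"
    using G unfolding multigraph_def by auto
  have all: "filter_mset (\<lambda>e. e \<subseteq> ?V) (medges G) = medges G"
    unfolding filter_mset_eq_conv using edges(1) by simp
  then have self: "induced G ?V = G" unfolding induced_def by simp
  \<comment> \<open>For constant capacity \<open>D + 1\<close> each vertex weighs
    \<open>2 N - 1 + 2 N = 4 D + 3\<close>, so this bound is the claim up to rearrangement.\<close>
  have "pot ?N (mult G) (\<lambda>_. Suc D) ?V \<le> -2"
  proof (rule critical_pot[OF _ multiplicity_mult[OF G] fin])
    show "2 \<le> ?N" using assms(1) by simp
    show "\<not> col (mult G) (\<lambda>_. Suc D) ?V M" for M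
      using nc DF_colorable_induced_iff[OF G order_refl, of D] unfolding self by blast
    show "\<exists>M. col (mult G) (\<lambda>_. Suc D) S M" if S: "S \<subset> ?V" for S
    proof -
      have "mverts (induced G S) = S" using S unfolding induced_def by auto
      then have "induced G S \<noteq> G" using S by auto
      then have "proper_subgraph (induced G S) G"
        using multigraph_induced[OF G] unfolding proper_subgraph_def subgraph_def
        by (auto simp: induced_def multiset_filter_subset)
      then show ?thesis using crit DF_colorable_induced_iff[OF G] S by blast
    qed
  qed simp
  moreover have "links (mult G) ?V ?V = 2 * int (size (medges G))"
    using links_count_self[OF fin edges(2)] all by simp
  ultimately have "(4 * int D + 3) * int (card ?V) + 2 \<le> 2 * (int D + 1) * int (size (medges G))"
    unfolding pot_def by (simp add: algebra_simps)
  then have "real_of_int ((4 * int D + 3) * int (card ?V) + 2) \<le> real_of_int (2 * (int D + 1) * int (size (medges G)))"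
    by (simp only: of_int_le_iff)
  then have "(4 * real D + 3) * real (card ?V) + 2 \<le> real (size (medges G)) * (2 * (real D + 1))"
    by (simp add: algebra_simps)
  then show ?thesis by (simp add: pos_divide_le_eq)
qed

end
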